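(* Let $d\geq3$ be an integer and let $\mathcal{H}$ be a homogeneous foliation of degree $d-1$ on $\mathbb{P}^2_{\mathbb{C}}$, with line at infinity $L_\infty$. Then $$K(\mathrm{Leg}(L_\infty\boxtimes\mathcal{H}))=K(\mathrm{Leg}\,\mathcal{H}).$$ In particular, the $d$-web $\mathrm{Leg}(L_\infty\boxtimes\mathcal{H})$ is flat if and only if the $(d-1)$-web $\mathrm{Leg}\,\mathcal{H}$ is flat.
   Context: A foliation $\mathcal H$ of degree $d-1$ on $\mathbb{P}^2_{\mathbb{C}}$ is homogeneous if in some affine chart $(x,y)$ it is invariant under all homotheties $(x,y)\mapsto\lambda(x,y)$, $\lambda\in\mathbb{C}^*$; then it is defined in that chart by $A\,dx+B\,dy$ with $A,B\in\mathbb{C}[x,y]_{d-1}$ and $\gcd(A,B)=1$. $L_\infty$ is the line at infinity of that chart. For a line $\ell$, $\ell\boxtimes\mathcal H$ denotes the pre-foliation of co-degree $1$ and degree $d$ given by the pair $(\ell,\mathcal H)$. Legendre transform. In the affine chart $(p,q)$ of $\check{\mathbb{P}}^2_{\mathbb{C}}$ associated to the line $\{y=px-q\}$, $\mathrm{Leg}\,\mathcal H$ is the $(d-1)$-web given by $A(x,px-q)+pB(x,px-q)=0$ with $x=dq/dp$ (its tangents at a generic $L\in\check{\mathbb{P}}^2_{\mathbb{C}}$ are the lines dual to the tangency points of $L$ with $\mathcal H$). $\mathrm{Leg}\,\ell$ is the foliation of $\check{\mathbb{P}}^2_{\mathbb{C}}$ by lines through the point dual to $\ell$ (for $\ell=L_\infty$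 it is $dp=0$), and $\mathrm{Leg}(\ell\boxtimes\mathcal H)=\mathrm{Leg}\,\ell\boxtimes\mathrm{Leg}\,\mathcal H$ is their superposition. Curvature. At a generic point a $k$-web $\mathcal W$ is a superposition $\mathcal F_1\boxtimes\cdots\boxtimes\mathcal F_k$ of $k$ pairwise transverse foliations, $\mathcal F_i:\omega_i=0$. Put $\omega_i\wedge\omega_j=\delta_{ij}\,dx\wedge dy$. For $r<s<t$ let $\eta_{rst}$ be the unique meromorphic 1-form with $d(\delta_{st}\omega_r)=\eta_{rst}\wedge\delta_{st}\omega_r$, $d(\delta_{tr}\omega_s)=\eta_{rst}\wedge\delta_{tr}\omega_s$, $d(\delta_{rs}\omega_t)=\eta_{rst}\wedge\delta_{rs}\omega_t$. The curvature $K(\mathcal W)=d\big(\sum_{r<s<t}\eta_{rst}\big)$ is a well-defined global meromorphic 2-form (zero if $k\le2$); $\mathcal W$ is flat if $K(\mathcal W)\equiv0$. *)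

theory Defs
  imports "HOL-Analysis.Analysis" "HOL-Computational_Algebra.Polynomial_Factorial"
begin

type_synonym point = "complex \<times> complex"

text \<open>"Generic" means: on a dense open set.\<close>

definition generically :: "(point \<Rightarrow> bool) \<Rightarrow> bool" where
  "generically P \<longleftrightarrow> (\<exists>U. open U \<and> closure U = UNIV \<and> (\<forall>z\<in>U. P z))"

section \<open>Foliations of the projective plane, read in an affine chart\<close>

text \<open>A polynomial in \<open>\<complex>[x,y]\<close> is encoded as an element of \<open>\<complex>[x][y]\<close>: the outer variable is \<open>y\<close>,
  the coefficients are polynomials in \<open>x\<close>.\<close>

type_synonym bipoly = "complex poly poly"

definition eval2 :: "bipoly \<Rightarrow> complex \<Rightarrow> complex \<Rightarrow> complex" where
  "eval2 A x y = poly (poly A [:y:]) x"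

text \<open>The pair \<open>(A, B)\<close> stands for the foliation defined by \<open>A dx + B dy\<close>. Every foliation of the
  projective plane is given in the chart by such a form with coprime coefficients.\<close>

type_synonym foliation = "bipoly \<times> bipoly"

text \<open>Restriction of \<open>A dx + B dy\<close> to the line \<open>y = p x - q\<close>, as a polynomial in the parameter \<open>x\<close>:
  it is \<open>A(x, px - q) + p B(x, px - q)\<close>, and its roots are the tangency points of the line with the
  foliation.\<close>

definition tangency :: "foliation \<Rightarrow> point \<Rightarrow> complex poly" where
  "tangency = (\<lambda>(A, B) (p, q). poly A [:-q, p:] + smult p (poly B [:-q, p:]))"

text \<open>The degree of a foliation is the number of its tangency points with a generic line, counted
  with multiplicity. (A generic line is not tangent to the foliation at infinity.)\<close>

definition foliation_of_degree :: "nat \<Rightarrow> foliation \<Rightarrow> bool" where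
  "foliation_of_degree n H \<longleftrightarrow>
     coprime (fst H) (snd H) \<and> generically (\<lambda>z. degree (tangency H z) = n)"

text \<open>Invariance under every homothety \<open>h(x,y) = (lx, ly)\<close>: the forms \<open>h\<^sup>*(A dx + B dy)\<close> and
  \<open>A dx + B dy\<close> are collinear.\<close>

definition homogeneous :: "foliation \<Rightarrow> bool" where
  "homogeneous = (\<lambda>(A, B). \<forall>l x y. l \<noteq> 0 \<longrightarrow>
     eval2 A (l * x) (l * y) * eval2 B x y = eval2 B (l * x) (l * y) * eval2 A x y)"

text \<open>The line \<open>a x + b y + c z = 0\<close> in homogeneous coordinates \<open>(x : y : z)\<close>, where \<open>z = 1\<close> is the
  affine chart.\<close>

type_synonym line = "complex \<times> complex \<times> complex"

definition line_infinity :: line where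
  "line_infinity = (0, 0, 1)"

type_synonym prefoliation = "line \<times> foliation"

section \<open>Holomorphic one-forms in two variables\<close>

definition holomorphic2_on :: "(point \<Rightarrow> complex) \<Rightarrow> point set \<Rightarrow> bool" where
  "holomorphic2_on f U \<longleftrightarrow>
     (\<forall>z\<in>U. \<exists>a b. (f has_derivative (\<lambda>v. a * fst v + b * snd v)) (at z))"

definition d1 :: "(point \<Rightarrow> complex) \<Rightarrow> point \<Rightarrow> complex" where
  "d1 f z = deriv (\<lambda>s. f (s, snd z)) (fst z)"

definition d2 :: "(point \<Rightarrow> complex) \<Rightarrow> point \<Rightarrow> complex" where
  "d2 f z = deriv (\<lambda>s. f (fst z, s)) (snd z)"

text \<open>The value \<open>(a, b)\<close> stands for \<open>a dp + b dq\<close>; a two-form is represented by its coefficient with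
  respect to \<open>dp \<and> dq\<close>.\<close>

type_synonym one_form = "point \<Rightarrow> complex \<times> complex"
type_synonym two_form = "point \<Rightarrow> complex"

definition wedge :: "one_form \<Rightarrow> one_form \<Rightarrow> two_form" where
  "wedge w w' z = fst (w z) * snd (w' z) - snd (w z) * fst (w' z)"

definition fmult :: "(point \<Rightarrow> complex) \<Rightarrow> one_form \<Rightarrow> one_form" where
  "fmult f w z = (f z * fst (w z), f z * snd (w z))"

definition ext_d :: "one_form \<Rightarrow> two_form" where
  "ext_d w z = d1 (\<lambda>u. snd (w u)) z - d2 (\<lambda>u. fst (w u)) z"

definition form_kernel :: "one_form \<Rightarrow> point \<Rightarrow> (complex \<times> complex) set" where
  "form_kernel w z = {v. fst (w z) * fst v + snd (w z) * snd v = 0}"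

section \<open>Webs and their curvature\<close>

text \<open>A web is given by its tangent lines: \<open>W z\<close> is the set of tangent directions at \<open>z\<close>, each
  of them a line in the tangent space \<open>\<complex>\<^sup>2\<close>. Only the values at generic points matter.\<close>

type_synonym web = "point \<Rightarrow> (complex \<times> complex) set set"

definition superpose :: "web \<Rightarrow> web \<Rightarrow> web"  (infixl "\<boxtimes>" 65) where
  "(W \<boxtimes> W') z = W z \<union> W' z"

text \<open>On \<open>U\<close>, \<open>W\<close> is the superposition of the pairwise transverse foliations
  \<open>w 0 = 0, \<dots>, w (k - 1) = 0\<close>.\<close>

definition web_forms :: "nat \<Rightarrow> web \<Rightarrow> point set \<Rightarrow> (nat \<Rightarrow> one_form) \<Rightarrow> bool" where
  "web_forms k W U w \<longleftrightarrow> open U \<and>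
     (\<forall>i<k. holomorphic2_on (\<lambda>z. fst (w i z)) U \<and> holomorphic2_on (\<lambda>z. snd (w i z)) U) \<and>
     (\<forall>i<k. \<forall>z\<in>U. w i z \<noteq> 0) \<and>
     (\<forall>i<k. \<forall>j<k. i \<noteq> j \<longrightarrow> (\<forall>z\<in>U. wedge (w i) (w j) z \<noteq> 0)) \<and>
     (\<forall>z\<in>U. W z = (\<lambda>i. form_kernel (w i) z) ` {..<k})"

definition web_regular_at :: "nat \<Rightarrow> web \<Rightarrow> point \<Rightarrow> bool" where
  "web_regular_at k W z \<longleftrightarrow> (\<exists>U w. z \<in> U \<and> web_forms k W U w)"

definition is_web :: "nat \<Rightarrow> web \<Rightarrow> bool" where
  "is_web k W \<longleftrightarrow> generically (web_regular_at k W)"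

text \<open>The equations defining \<open>\<eta>\<close> involve no derivative of \<open>\<eta>\<close>, so that \<open>\<eta>\<close> can be determined
  point by point.\<close>

definition eta :: "one_form \<Rightarrow> one_form \<Rightarrow> one_form \<Rightarrow> one_form" where
  "eta wr ws wt z = (THE e.
     ext_d (fmult (wedge ws wt) wr) z = wedge (\<lambda>_. e) (fmult (wedge ws wt) wr) z \<and>
     ext_d (fmult (wedge wt wr) ws) z = wedge (\<lambda>_. e) (fmult (wedge wt wr) ws) z \<and>
     ext_d (fmult (wedge wr ws) wt) z = wedge (\<lambda>_. e) (fmult (wedge wr ws) wt) z)"

definition forms_curvature :: "nat \<Rightarrow> (nat \<Rightarrow> one_form) \<Rightarrow> two_form" where
  "forms_curvature k w =
     ext_d (\<lambda>z. \<Sum>(r, s, t) \<in> {(r, s, t). r < s \<and> s < t \<and> t < k}. eta (w r) (w s) (w t) z)"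

text \<open>The curvature does not depend on the local forms chosen. As a meromorphic two-form it is
  determined by its values at the regular points; elsewhere the value below is a dummy.\<close>

definition curvature :: "nat \<Rightarrow> web \<Rightarrow> two_form" where
  "curvature k W z = (THE c. \<exists>U w. z \<in> U \<and> web_forms k W U w \<and> c = forms_curvature k w z)"

definition flat_web :: "nat \<Rightarrow> web \<Rightarrow> bool" where
  "flat_web k W \<longleftrightarrow> (\<forall>z. web_regular_at k W z \<longrightarrow> curvature k W z = 0)"

section \<open>Legendre transform\<close>

text \<open>The point \<open>(p, q)\<close> of the dual plane is the line \<open>y = p x - q\<close>. The lines through \<open>(x, y)\<close> form
  the dual line \<open>q = x p - y\<close>, which has direction \<open>(1, x)\<close>. Where the degree of the tangency
  polynomial drops, a vertical tangent direction is lost; this happens at no generic point.\<close>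

definition leg_foliation :: "foliation \<Rightarrow> web" where
  "leg_foliation H z = {{v. snd v = x * fst v} | x. poly (tangency H z) x = 0}"

text \<open>The dual point of \<open>a x + b y + c z = 0\<close> is \<open>(a : b : c)\<close>, and \<open>(p, q)\<close> is \<open>(p : -1 : -q)\<close>. The
  foliation by lines through \<open>(a : b : c)\<close> is therefore defined by the determinant of the rows
  \<open>(p, -1, -q)\<close>, \<open>(a, b, c)\<close>, \<open>(dp, 0, -dq)\<close>, which is \<open>(b q - c) dp - (a + b p) dq\<close>.\<close>

definition leg_line :: "line \<Rightarrow> web" where
  "leg_line = (\<lambda>(a, b, c) (p, q). {form_kernel (\<lambda>_. (b * q - c, - (a + b * p))) (p, q)})"

definition leg_prefoliation :: "prefoliation \<Rightarrow> web" where
  "leg_prefoliation = (\<lambda>(l, H). leg_line l \<boxtimes> leg_foliation H)"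

end

theory Submission
  imports Defs "HOL-Complex_Analysis.Complex_Analysis"
    "HOL-Computational_Algebra.Fundamental_Theorem_Algebra"
    "HOL-Computational_Algebra.Field_as_Ring"
begin

text \<open>In the chart \<open>(p, q)\<close> both webs are invariant under \<open>q \<partial>/\<partial>q\<close>: by homogeneity the slopes of
  \<open>Leg H\<close> are \<open>q s\<^sub>i(p)\<close>, so its foliations are defined by the closed forms \<open>s\<^sub>i(p) dp - dq / q\<close>, and
  \<open>Leg L\<^sub>\<infinity>\<close> is defined by \<open>dp\<close>. For \<open>\<omega>\<^sub>0 = dp\<close> and two foliations of \<open>Leg H\<close> the form \<open>\<eta>\<close> is
  \<open>- dq / q\<close>, which is closed: the triples containing \<open>Leg L\<^sub>\<infinity>\<close> do not contribute to the curvature.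
  Rescaling the three forms of a triple by holomorphic functions adds to \<open>\<eta>\<close> the logarithmic
  differential of their product, so the curvature does not depend on the local forms.\<close>

section \<open>Separately holomorphic functions of two variables\<close>

text \<open>The curvature is a definite description over all local decompositions, so it cannot be
  computed from the convenient forms alone: the forms met at a regular point are arbitrary multiples
  of them, arbitrarily numbered, and the position of \<open>dp\<close> among them is unknown. That a
  logarithmic differential is closed is the symmetry of second partial derivatives; for functions
  known only to be complex differentiable it is drawn here from Cauchy's integral formula.
  Continuity together with holomorphy in each variable is a convenient class for this, since it is
  stable under both partial derivatives. The numbering is removed by passing to the sum over all
  ordered triples of distinct indices, which is six times the defining one. Finally, regularity
  itself excludes \<open>q = 0\<close>: there the slope equation has at most the root 0 or holds
  identically, and neither leaves a finite number, at least two, of distinct directions. This is one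
  use of d \<ge> 3; the other excludes the radial foliation.\<close>

definition separately_holomorphic_on :: "(point \<Rightarrow> complex) \<Rightarrow> point set \<Rightarrow> bool" where
  "separately_holomorphic_on f D \<longleftrightarrow> continuous_on D f \<and>
     (\<forall>z\<in>D. (\<lambda>s. f (s, snd z)) field_differentiable at (fst z) \<and>
            (\<lambda>s. f (fst z, s)) field_differentiable at (snd z))"

lemma holomorphic2_imp_separately:
  assumes "holomorphic2_on f D"
  shows "separately_holomorphic_on f D"
proof -
  have 1: "isCont f z \<and> (\<lambda>s. f (s, snd z)) field_differentiable at (fst z) \<and>
      (\<lambda>s. f (fst z, s)) field_differentiable at (snd z)" if z: "z \<in> D" for z
  proof -
    obtain a b where ab: "(f has_derivative (\<lambda>v. a * fst v + b * snd v)) (at z)"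
      using assms z unfolding holomorphic2_on_def by blast
    have ab': "(f has_derivative (\<lambda>v. a * fst v + b * snd v)) (at (fst z, snd z))"
      using ab by simp
    have "((\<lambda>s. (s, snd z)) has_derivative (\<lambda>v. (v, 0))) (at (fst z))"
      by (auto intro!: derivative_eq_intros)
    from has_derivative_compose[OF this ab']
    have "((\<lambda>s. f (s, snd z)) has_field_derivative a) (at (fst z))"
      by (simp add: has_field_derivative_def)
    moreover have "((\<lambda>s. (fst z, s)) has_derivative (\<lambda>v. (0, v))) (at (snd z))"
      by (auto intro!: derivative_eq_intros)
    from has_derivative_compose[OF this ab']
    have "((\<lambda>s. f (fst z, s)) has_field_derivative b) (at (snd z))"
      by (simp add: has_field_derivative_def)
    ultimately show ?thesis
      using has_derivative_continuous[OF ab] by (auto simp: field_differentiable_def)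
  qed
  then show ?thesis
    unfolding separately_holomorphic_on_def by (simp add: continuous_at_imp_continuous_on)
qed

lemma separately_holomorphic_subset:
  "separately_holomorphic_on f D \<Longrightarrow> E \<subseteq> D \<Longrightarrow> separately_holomorphic_on f E"
  unfolding separately_holomorphic_on_def using continuous_on_subset by blast

lemma separately_holomorphic_mult:
  "separately_holomorphic_on f D \<Longrightarrow> separately_holomorphic_on g D \<Longrightarrow>
   separately_holomorphic_on (\<lambda>z. f z * g z) D"
  unfolding separately_holomorphic_on_def
  by (auto intro!: continuous_intros field_differentiable_mult)

lemma separately_holomorphic_minus:
  "separately_holomorphic_on f D \<Longrightarrow> separately_holomorphic_on (\<lambda>z. - f z) D"
  unfolding separately_holomorphic_on_def
  by (auto intro!: continuous_intros field_differentiable_minus)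

lemma separately_holomorphic_snd: "separately_holomorphic_on snd D"
  unfolding separately_holomorphic_on_def
  by (auto intro!: continuous_intros)

lemma d1_deriv:
  assumes "separately_holomorphic_on f D" "z \<in> D"
  shows "((\<lambda>s. f (s, snd z)) has_field_derivative d1 f z) (at (fst z))"
  using assms unfolding separately_holomorphic_on_def d1_def
  by (auto simp: field_differentiable_derivI)

lemma d2_deriv:
  assumes "separately_holomorphic_on f D" "z \<in> D"
  shows "((\<lambda>s. f (fst z, s)) has_field_derivative d2 f z) (at (snd z))"
  using assms unfolding separately_holomorphic_on_def d2_def
  by (auto simp: field_differentiable_derivI)

lemma separately_holomorphic_swap:
  assumes "separately_holomorphic_on f D"
  shows "separately_holomorphic_on (f \<circ> prod.swap) (prod.swap ` D)"
proof -
  have "continuous_on (prod.swap ` D) (f \<circ> prod.swap)"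
    using assms unfolding separately_holomorphic_on_def
    by (intro continuous_on_compose) (auto simp: image_image intro!: continuous_on_swap)
  then show ?thesis
    using assms unfolding separately_holomorphic_on_def by auto
qed

lemma open_swap_image:
  fixes D :: "point set"
  assumes "open D"
  shows "open (prod.swap ` D)"
proof -
  have "prod.swap ` D = prod.swap -` D" by force
  then show ?thesis
    using assms by (simp add: open_vimage continuous_on_swap)
qed

lemma d2_eq_d1_swap: "d2 f z = d1 (f \<circ> prod.swap) (prod.swap z)"
  by (simp add: d1_def d2_def)

section \<open>Cauchy's formula and the symmetry of second derivatives\<close>

definition cauchy_kernel :: "complex \<Rightarrow> real \<Rightarrow> complex \<Rightarrow> real \<Rightarrow> complex" where
  "cauchy_kernel a r p t =
     of_real r * exp (2 * of_real pi * \<i> * of_real t) / (circlepath a r t - p)\<^sup>2"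

lemma continuous_on_cauchy_kernel:
  assumes "0 < r"
  shows "continuous_on (ball a r \<times> cbox 0 1) (\<lambda>(p, t). cauchy_kernel a r p t)"
proof -
  have "circlepath a r t \<noteq> p" if "p \<in> ball a r" for p t
    using that assms by (auto simp: circlepath dist_norm norm_mult)
  then show ?thesis
    unfolding cauchy_kernel_def circlepath case_prod_unfold
    by (intro continuous_intros) auto
qed

text \<open>Cauchy's formula for the first derivative on the circle parametrized by
  \<open>[0, 1]\<close>; the factor \<open>2 pi i\<close> of the velocity of
  \<open>circlepath\<close> cancels against the one in front of the integral, which leaves
  \<open>cauchy_kernel\<close>. The gain is that \<open>p\<close> enters only through the kernel and
  \<open>q\<close> only through \<open>f\<close>.\<close>

lemma d1_eq_integral:
  assumes sep: "separately_holomorphic_on f D" and r: "0 < r"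
    and D: "\<And>s. s \<in> cball a r \<Longrightarrow> (s, q) \<in> D" and p: "p \<in> ball a r"
  shows "d1 f (p, q) = integral (cbox 0 1) (\<lambda>t. f (circlepath a r t, q) * cauchy_kernel a r p t)"
proof -
  let ?h = "\<lambda>s. f (s, q)"
  have fd: "?h field_differentiable at s" if "s \<in> cball a r" for s
    using sep D[OF that] unfolding separately_holomorphic_on_def by force
  have hol: "?h holomorphic_on ball a r"
    using fd by (auto simp: holomorphic_on_def intro: field_differentiable_at_within)
  have cont: "continuous_on (cball a r) ?h"
    using fd by (intro continuous_at_imp_continuous_on) (auto intro: field_differentiable_imp_continuous_at)
  have "((\<lambda>u. ?h u / (u - p) ^ Suc 1) has_contour_integral
      (2 * pi * \<i>) / (fact 1) * (deriv ^^ 1) ?h p) (circlepath a r)"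
    by (rule Cauchy_has_contour_integral_higher_derivative_circlepath[OF cont hol p])
  then have "((\<lambda>t. ?h (circlepath a r t) / (circlepath a r t - p)\<^sup>2 *
      (2 * of_real pi * \<i> * r * exp (2 * of_real pi * \<i> * of_real t))) has_integral
      (2 * pi * \<i>) * deriv ?h p) {0..1}"
    by (simp add: has_contour_integral vector_derivative_circlepath numeral_2_eq_2)
  from has_integral_mult_right[OF this, of "1 / (2 * pi * \<i>)"]
  have "((\<lambda>t. ?h (circlepath a r t) * cauchy_kernel a r p t) has_integral deriv ?h p) {0..1}"
    by (simp add: cauchy_kernel_def field_simps)
  then show ?thesis
    by (simp add: d1_def integral_unique)
qed

lemma circlepath_in_cball: "0 < r \<Longrightarrow> circlepath a r t \<in> cball a r"
  by (auto simp: circlepath dist_norm norm_mult)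

lemma continuous_on_circlepath_param:
  assumes "continuous_on D f" "0 < r" "cball a r \<times> T \<subseteq> D"
  shows "continuous_on ((ball a r \<times> T) \<times> cbox 0 1)
      (\<lambda>(z, t). f (circlepath a r t, snd z) * cauchy_kernel a r (fst z) t)"
proof -
  have 1: "continuous_on ((ball a r \<times> T) \<times> cbox 0 1) (\<lambda>w. f (circlepath a r (snd w), snd (fst w)))"
    by (rule continuous_on_compose2[OF assms(1)])
       (use assms circlepath_in_cball in \<open>auto simp: circlepath intro!: continuous_intros\<close>)
  have 2: "continuous_on ((ball a r \<times> T) \<times> cbox 0 1) (\<lambda>w. cauchy_kernel a r (fst (fst w)) (snd w))"
  proof -
    have "continuous_on ((ball a r \<times> T) \<times> cbox 0 1)
        (\<lambda>w. case (fst (fst w), snd w) of (p, t) \<Rightarrow> cauchy_kernel a r p t)"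
      by (rule continuous_on_compose2[OF continuous_on_cauchy_kernel[OF assms(2)]])
        (auto intro!: continuous_intros)
    then show ?thesis by simp
  qed
  show ?thesis
    using continuous_on_mult[OF 1 2] by (simp add: case_prod_unfold)
qed

text \<open>The discs are closed because the circles of integration are their boundaries.\<close>

lemma box_in_open:
  fixes z :: point
  assumes "open D" "z \<in> D"
  obtains r where "0 < r" "cball (fst z) r \<times> cball (snd z) r \<subseteq> D"
proof -
  obtain A B where AB: "open A" "open B" "fst z \<in> A" "snd z \<in> B" "A \<times> B \<subseteq> D"
    using assms by (metis open_prod_elim mem_Times_iff)
  obtain r1 r2 where "0 < r1" "cball (fst z) r1 \<subseteq> A" "0 < r2" "cball (snd z) r2 \<subseteq> B"
    using AB by (meson open_contains_cball)
  then show ?thesis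
    using AB by (intro that[of "min r1 r2"]) (auto simp: subset_iff)
qed

lemma continuous_on_d1:
  assumes sep: "separately_holomorphic_on f D" and D: "open D"
  shows "continuous_on D (d1 f)"
proof (rule continuous_at_imp_continuous_on, rule ballI)
  fix z assume z: "z \<in> D"
  obtain r where r: "0 < r" "cball (fst z) r \<times> cball (snd z) r \<subseteq> D"
    using box_in_open[OF D z] .
  let ?B = "ball (fst z) r \<times> ball (snd z) r"
  have "continuous_on ?B (\<lambda>w. integral (cbox 0 1)
      (\<lambda>t. f (circlepath (fst z) r t, snd w) * cauchy_kernel (fst z) r (fst w) t))"
    by (rule integral_continuous_on_param, rule continuous_on_circlepath_param[where D = D])
       (use sep r in \<open>auto simp: separately_holomorphic_on_def\<close>)
  moreover have "d1 f w = integral (cbox 0 1)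
      (\<lambda>t. f (circlepath (fst z) r t, snd w) * cauchy_kernel (fst z) r (fst w) t)" if "w \<in> ?B" for w
  proof -
    have "d1 f (fst w, snd w) = integral (cbox 0 1)
        (\<lambda>t. f (circlepath (fst z) r t, snd w) * cauchy_kernel (fst z) r (fst w) t)"
      using r that by (intro d1_eq_integral[OF sep r(1)]) auto
    then show ?thesis by simp
  qed
  ultimately have "continuous_on ?B (d1 f)"
    by (simp cong: continuous_on_cong)
  then show "isCont (d1 f) z"
    using continuous_on_interior[of ?B "d1 f" z] r(1)
    by (simp add: open_Times interior_open mem_Times_iff)
qed

lemma continuous_on_d2:
  assumes sep: "separately_holomorphic_on f D" and D: "open D"
  shows "continuous_on D (d2 f)"
proof -
  have "open (prod.swap ` D)"
    using D by (rule open_swap_image)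
  then have "continuous_on (prod.swap ` D) (d1 (f \<circ> prod.swap))"
    using continuous_on_d1 separately_holomorphic_swap sep by blast
  then have "continuous_on D (d1 (f \<circ> prod.swap) \<circ> prod.swap)"
    by (intro continuous_on_compose continuous_on_swap) auto
  then show ?thesis by (simp add: d2_eq_d1_swap[abs_def] comp_def)
qed

text \<open>Differentiation under the integral sign: the kernel does not contain \<open>q\<close>,
  so the derivative falls on \<open>f\<close> alone. The resulting integral is also what Cauchy's
  formula gives for \<open>d1 (d2 f)\<close>.\<close>

lemma d2_d1_has_integral:
  assumes sep: "separately_holomorphic_on f D" and D: "open D" and r: "0 < r"
    and sub: "cball a r \<times> cball b r \<subseteq> D" and p: "p \<in> ball a r" and q: "q \<in> ball b r"
  shows "((\<lambda>s. d1 f (p, s)) has_field_derivative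
      integral (cbox 0 1) (\<lambda>t. d2 f (circlepath a r t, q) * cauchy_kernel a r p t)) (at q)"
proof -
  let ?F = "\<lambda>s t. f (circlepath a r t, s) * cauchy_kernel a r p t"
  let ?G = "\<lambda>s t. d2 f (circlepath a r t, s) * cauchy_kernel a r p t"
  have sub': "(circlepath a r t, s) \<in> D" if "s \<in> ball b r" for s t
    using sub circlepath_in_cball[OF r, of a t] that by auto
  have slice: "continuous_on (ball b r \<times> cbox 0 1) (\<lambda>(s, t). g (circlepath a r t, s) * cauchy_kernel a r p t)"
    if "continuous_on D g" for g :: "point \<Rightarrow> complex"
  proof -
    have "continuous_on ((ball a r \<times> ball b r) \<times> cbox 0 1)
      (\<lambda>(z, t). g (circlepath a r t, snd z) * cauchy_kernel a r (fst z) t)"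
      using sub by (intro continuous_on_circlepath_param[OF that r]) auto
    then have "continuous_on (ball b r \<times> cbox 0 1)
      (\<lambda>w. case ((p, fst w), snd w) of (z, t) \<Rightarrow> g (circlepath a r t, snd z) * cauchy_kernel a r (fst z) t)"
      by (rule continuous_on_compose2) (use p in \<open>auto intro!: continuous_intros\<close>)
    then show ?thesis by (simp add: case_prod_unfold)
  qed
  have "((\<lambda>s. integral (cbox 0 1) (?F s)) has_field_derivative integral (cbox 0 1) (?G q)) (at q within ball b r)"
  proof (rule leibniz_rule_field_derivative)
    fix s t assume s: "s \<in> ball b r"
    have "((\<lambda>s. f (circlepath a r t, s)) has_field_derivative d2 f (circlepath a r t, s)) (at s)"
      using d2_deriv[OF sep sub'[OF s, of t]] by simp
    then show "((\<lambda>s. ?F s t) has_field_derivative ?G s t) (at s within ball b r)"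
      by (rule DERIV_cmult_right[OF has_field_derivative_at_within])
  next
    fix s assume s: "s \<in> ball b r"
    have "continuous_on D f" using sep by (simp add: separately_holomorphic_on_def)
    then have "continuous_on (cbox 0 1)
        (\<lambda>t. case (s, t) of (s, t) \<Rightarrow> f (circlepath a r t, s) * cauchy_kernel a r p t)"
      by (intro continuous_on_compose2[OF slice]) (use s in \<open>auto intro!: continuous_intros\<close>)
    then show "?F s integrable_on cbox 0 1"
      unfolding prod.case by (rule integrable_continuous)
  next
    show "continuous_on (ball b r \<times> cbox 0 1) (\<lambda>(s, t). ?G s t)"
      by (rule slice[OF continuous_on_d2[OF sep D]])
  qed (use q in auto)
  then have 1: "((\<lambda>s. integral (cbox 0 1) (?F s)) has_field_derivative integral (cbox 0 1) (?G q)) (at q)"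
    using q by (simp add: at_within_open[of q "ball b r"])
  show ?thesis
  proof (rule DERIV_cong_ev[THEN iffD1, OF refl _ refl 1])
    have "\<forall>\<^sub>F s in nhds q. s \<in> ball b r"
      by (rule eventually_nhds_in_open[OF open_ball q])
    then show "\<forall>\<^sub>F s in nhds q. integral (cbox 0 1) (?F s) = d1 f (p, s)"
      by eventually_elim (rule d1_eq_integral[OF sep r _ p, symmetric], use sub in auto)
  qed
qed

text \<open>In the first variable this is one-variable holomorphy of a derivative; in the second it
  needs the differentiated Cauchy integral.\<close>

lemma separately_holomorphic_d1:
  assumes sep: "separately_holomorphic_on f D" and D: "open D"
  shows "separately_holomorphic_on (d1 f) D"
  unfolding separately_holomorphic_on_def
proof (intro conjI ballI)
  show "continuous_on D (d1 f)" using continuous_on_d1 assms .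
next
  fix z assume z: "z \<in> D"
  obtain r where r: "0 < r" "cball (fst z) r \<times> cball (snd z) r \<subseteq> D"
    using box_in_open[OF D z] .
  have "(\<lambda>s. f (s, snd z)) holomorphic_on ball (fst z) r"
    unfolding holomorphic_on_def
  proof
    fix s assume s: "s \<in> ball (fst z) r"
    then have D': "(s, snd z) \<in> D" using r by auto
    show "(\<lambda>s. f (s, snd z)) field_differentiable at s within ball (fst z) r"
      using d1_deriv[OF sep D'] by (auto simp: field_differentiable_def intro: has_field_derivative_at_within)
  qed
  then have "deriv (\<lambda>s. f (s, snd z)) holomorphic_on ball (fst z) r"
    by (rule holomorphic_deriv) auto
  then show "(\<lambda>s. d1 f (s, snd z)) field_differentiable at (fst z)"
    using r(1) by (simp add: d1_def[abs_def] holomorphic_on_imp_differentiable_at[of _ "ball (fst z) r"])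
  show "(\<lambda>s. d1 f (fst z, s)) field_differentiable at (snd z)"
    using d2_d1_has_integral[OF sep D r, of "fst z" "snd z"] r(1)
    by (auto simp: field_differentiable_def)
qed

lemma separately_holomorphic_d2:
  assumes sep: "separately_holomorphic_on f D" and D: "open D"
  shows "separately_holomorphic_on (d2 f) D"
proof -
  have "separately_holomorphic_on (d1 (f \<circ> prod.swap)) (prod.swap ` D)"
    using open_swap_image[OF D] separately_holomorphic_swap[OF sep] separately_holomorphic_d1 by blast
  from separately_holomorphic_swap[OF this] show ?thesis
    by (simp add: d2_eq_d1_swap[abs_def] comp_def image_image)
qed

lemma d1_d2_commute:
  assumes sep: "separately_holomorphic_on f D" and D: "open D" and z: "z \<in> D"
  shows "d2 (d1 f) z = d1 (d2 f) z"
proof -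
  obtain r where r: "0 < r" "cball (fst z) r \<times> cball (snd z) r \<subseteq> D"
    using box_in_open[OF D z] .
  have "d2 (d1 f) z = integral (cbox 0 1)
      (\<lambda>t. d2 f (circlepath (fst z) r t, snd z) * cauchy_kernel (fst z) r (fst z) t)"
    unfolding d2_def[of "d1 f"] using r
    by (intro DERIV_imp_deriv d2_d1_has_integral[OF sep D r]) auto
  also have "\<dots> = d1 (d2 f) (fst z, snd z)"
    using r by (intro d1_eq_integral[OF separately_holomorphic_d2[OF sep D] r(1), symmetric]) auto
  finally show ?thesis by simp
qed

section \<open>Curvature of invariant forms\<close>

lemma d1_eqI: "((\<lambda>s. f (s, snd z)) has_field_derivative a) (at (fst z)) \<Longrightarrow> d1 f z = a"
  unfolding d1_def by (rule DERIV_imp_deriv)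

lemma d2_eqI: "((\<lambda>s. f (fst z, s)) has_field_derivative a) (at (snd z)) \<Longrightarrow> d2 f z = a"
  unfolding d2_def by (rule DERIV_imp_deriv)

text \<open>The difference of two solutions has zero wedge with \<open>wr\<close> and with
  \<open>ws\<close>. These are independent at \<open>z\<close>, so by Cramer's rule the difference
  vanishes.\<close>

lemma eta_eqI:
  assumes st: "wedge ws wt z \<noteq> 0" and tr: "wedge wt wr z \<noteq> 0" and rs: "wedge wr ws z \<noteq> 0"
    and e: "ext_d (fmult (wedge ws wt) wr) z = wedge (\<lambda>_. e) (fmult (wedge ws wt) wr) z"
      "ext_d (fmult (wedge wt wr) ws) z = wedge (\<lambda>_. e) (fmult (wedge wt wr) ws) z"
      "ext_d (fmult (wedge wr ws) wt) z = wedge (\<lambda>_. e) (fmult (wedge wr ws) wt) z"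
  shows "eta wr ws wt z = e"
  unfolding eta_def
proof (rule the_equality)
  fix e' assume e': "ext_d (fmult (wedge ws wt) wr) z = wedge (\<lambda>_. e') (fmult (wedge ws wt) wr) z \<and>
     ext_d (fmult (wedge wt wr) ws) z = wedge (\<lambda>_. e') (fmult (wedge wt wr) ws) z \<and>
     ext_d (fmult (wedge wr ws) wt) z = wedge (\<lambda>_. e') (fmult (wedge wr ws) wt) z"
  let ?x = "fst e' - fst e" and ?y = "snd e' - snd e"
  have "wedge ws wt z * (?x * snd (wr z) - ?y * fst (wr z)) = 0"
    using e(1) e' by (simp add: wedge_def fmult_def algebra_simps)
  then have 1: "?x * snd (wr z) = ?y * fst (wr z)" using st by simp
  have "wedge wt wr z * (?x * snd (ws z) - ?y * fst (ws z)) = 0"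
    using e(2) e' by (simp add: wedge_def fmult_def algebra_simps)
  then have 2: "?x * snd (ws z) = ?y * fst (ws z)" using tr by simp
  have "?x * wedge wr ws z = fst (wr z) * (?x * snd (ws z)) - (?x * snd (wr z)) * fst (ws z)"
    by (simp add: wedge_def algebra_simps)
  also have "\<dots> = 0" unfolding 1 2 by simp
  finally have "?x = 0" using rs by simp
  have "?y * wedge wr ws z = (?y * fst (wr z)) * snd (ws z) - snd (wr z) * (?y * fst (ws z))"
    by (simp add: wedge_def algebra_simps)
  also have "\<dots> = 0" unfolding 1[symmetric] 2[symmetric] by simp
  finally have "?y = 0" using rs by simp
  with \<open>?x = 0\<close> show "e' = e" by (simp add: prod_eq_iff)
qed (use e in auto)

text \<open>The forms \<open>g i (\<sigma> i dp - \<tau> i dq / q)\<close>: up to the factor \<open>g i\<close> they are closed and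
  invariant under the flow of \<open>q \<partial>/\<partial>q\<close>.\<close>

locale invariant_forms =
  fixes P Q :: "complex set" and I :: "nat set" and w :: "nat \<Rightarrow> one_form"
    and g :: "nat \<Rightarrow> point \<Rightarrow> complex" and \<sigma> :: "nat \<Rightarrow> complex \<Rightarrow> complex" and \<tau> :: "nat \<Rightarrow> complex"
  assumes open_P: "open P" and open_Q: "open Q" and Q_nz: "0 \<notin> Q"
    and holo: "i \<in> I \<Longrightarrow> \<sigma> i holomorphic_on P"
    and sep: "i \<in> I \<Longrightarrow> separately_holomorphic_on (g i) (P \<times> Q)"
    and g_nz: "i \<in> I \<Longrightarrow> z \<in> P \<times> Q \<Longrightarrow> g i z \<noteq> 0"
    and w_eq: "i \<in> I \<Longrightarrow> z \<in> P \<times> Q \<Longrightarrow> w i z = (g i z * \<sigma> i (fst z), - (g i z * \<tau> i / snd z))"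
    and transverse: "i \<in> I \<Longrightarrow> j \<in> I \<Longrightarrow> i \<noteq> j \<Longrightarrow> p \<in> P \<Longrightarrow> \<sigma> j p * \<tau> i \<noteq> \<sigma> i p * \<tau> j"
begin

text \<open>Up to the factors \<open>g\<close> and \<open>1 / q\<close> this is the wedge of the
  forms \<open>i\<close> and \<open>j\<close>.\<close>

definition cross :: "nat \<Rightarrow> nat \<Rightarrow> complex \<Rightarrow> complex" where
  "cross i j p = \<sigma> j p * \<tau> i - \<sigma> i p * \<tau> j"

text \<open>For \<open>g = 1\<close> the form \<open>\<eta>\<close> is \<open>eta1 dp + (eta2 - 1) dq / q\<close>.\<close>

definition eta1 :: "nat \<Rightarrow> nat \<Rightarrow> nat \<Rightarrow> complex \<Rightarrow> complex" where
  "eta1 r s t p = - (deriv (\<sigma> r) p * \<sigma> r p * \<tau> s * \<tau> t * cross s t p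
      + deriv (\<sigma> s) p * \<sigma> s p * \<tau> t * \<tau> r * cross t r p
      + deriv (\<sigma> t) p * \<sigma> t p * \<tau> r * \<tau> s * cross r s p)
      / (cross r s p * cross s t p * cross t r p)"

definition eta2 :: "nat \<Rightarrow> nat \<Rightarrow> nat \<Rightarrow> complex \<Rightarrow> complex" where
  "eta2 r s t p = \<tau> r * \<tau> s * \<tau> t * (deriv (\<sigma> r) p * cross s t p
      + deriv (\<sigma> s) p * cross t r p + deriv (\<sigma> t) p * cross r s p)
      / (cross r s p * cross s t p * cross t r p)"

text \<open>The three equations defining \<open>eta\<close> are cyclic rotations of one another, so
  with this invariance it suffices to verify one of them.\<close>

lemma eta1_rotate: "eta1 s t r p = eta1 r s t p"
  by (simp add: eta1_def algebra_simps)

lemma eta2_rotate: "eta2 s t r p = eta2 r s t p"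
  by (simp add: eta2_def algebra_simps)

text \<open>This is the first defining equation of \<open>eta\<close> for \<open>g = 1\<close>,
  multiplied by \<open>-q^2\<close>: the term coming from the derivative of \<open>1 / q\<close> is
  absorbed by the \<open>-1\<close> in the \<open>dq / q\<close> component. The three rotations form
  an overdetermined linear system in \<open>eta1\<close> and \<open>eta2\<close>, solved by the
  given quotients; after multiplication by the common denominator only a polynomial identity
  remains.\<close>

lemma eta12_equation:
  assumes "cross r s p \<noteq> 0" "cross s t p \<noteq> 0" "cross t r p \<noteq> 0"
  shows "\<tau> r * (deriv (\<sigma> t) p * \<tau> s - deriv (\<sigma> s) p * \<tau> t)
    = cross s t p * (\<tau> r * eta1 r s t p + \<sigma> r p * eta2 r s t p)"
proof -
  let ?M = "cross r s p * cross s t p * cross t r p"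
  have "?M * (cross s t p * (\<tau> r * eta1 r s t p + \<sigma> r p * eta2 r s t p))
     = cross s t p * (\<tau> r * (?M * eta1 r s t p) + \<sigma> r p * (?M * eta2 r s t p))"
    by (simp add: algebra_simps)
  also have "?M * eta1 r s t p = - (deriv (\<sigma> r) p * \<sigma> r p * \<tau> s * \<tau> t * cross s t p
      + deriv (\<sigma> s) p * \<sigma> s p * \<tau> t * \<tau> r * cross t r p
      + deriv (\<sigma> t) p * \<sigma> t p * \<tau> r * \<tau> s * cross r s p)"
    using assms by (simp add: eta1_def)
  also have "?M * eta2 r s t p = \<tau> r * \<tau> s * \<tau> t * (deriv (\<sigma> r) p * cross s t p
      + deriv (\<sigma> s) p * cross t r p + deriv (\<sigma> t) p * cross r s p)"
    using assms by (simp add: eta2_def)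
  also have "cross s t p * (\<tau> r * - (deriv (\<sigma> r) p * \<sigma> r p * \<tau> s * \<tau> t * cross s t p
      + deriv (\<sigma> s) p * \<sigma> s p * \<tau> t * \<tau> r * cross t r p
      + deriv (\<sigma> t) p * \<sigma> t p * \<tau> r * \<tau> s * cross r s p)
      + \<sigma> r p * (\<tau> r * \<tau> s * \<tau> t * (deriv (\<sigma> r) p * cross s t p
      + deriv (\<sigma> s) p * cross t r p + deriv (\<sigma> t) p * cross r s p)))
    = ?M * (\<tau> r * (deriv (\<sigma> t) p * \<tau> s - deriv (\<sigma> s) p * \<tau> t))"
    unfolding cross_def by algebra
  finally show ?thesis using assms by simp
qed

lemma cross_nz: "i \<in> I \<Longrightarrow> j \<in> I \<Longrightarrow> i \<noteq> j \<Longrightarrow> p \<in> P \<Longrightarrow> cross i j p \<noteq> 0"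
  using transverse by (simp add: cross_def)

lemma deriv_sigma: "i \<in> I \<Longrightarrow> p \<in> P \<Longrightarrow> (\<sigma> i has_field_derivative deriv (\<sigma> i) p) (at p)"
  using holo open_P by (rule holomorphic_derivI)

lemma cross_deriv:
  assumes "i \<in> I" "j \<in> I" "p \<in> P"
  shows "(cross i j has_field_derivative (deriv (\<sigma> j) p * \<tau> i - deriv (\<sigma> i) p * \<tau> j)) (at p)"
  unfolding cross_def[abs_def] using assms deriv_sigma by (auto intro!: derivative_eq_intros)

lemma wedge_w:
  assumes "i \<in> I" "j \<in> I" "z \<in> P \<times> Q"
  shows "wedge (w i) (w j) z = g i z * g j z * cross i j (fst z) / snd z"
  using assms by (simp add: wedge_def w_eq cross_def algebra_simps diff_divide_distrib)

lemma open_PQ: "open (P \<times> Q)"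
  using open_P open_Q by (rule open_Times)

lemma eventually_P: "p \<in> P \<Longrightarrow> eventually (\<lambda>s. s \<in> P) (nhds p)"
  using open_P by (rule eventually_nhds_in_open)

lemma eventually_Q: "q \<in> Q \<Longrightarrow> eventually (\<lambda>s. s \<in> Q) (nhds q)"
  using open_Q by (rule eventually_nhds_in_open)

text \<open>Each of the three forms whose differentials define \<open>eta\<close> consists of one
  form times the wedge of the other two, so all three are rescaled by this same product.\<close>

abbreviation factor :: "nat \<Rightarrow> nat \<Rightarrow> nat \<Rightarrow> point \<Rightarrow> complex" where
  "factor r s t \<equiv> (\<lambda>z. g r z * g s z * g t z)"

lemma factor_sep:
  "r \<in> I \<Longrightarrow> s \<in> I \<Longrightarrow> t \<in> I \<Longrightarrow> separately_holomorphic_on (factor r s t) (P \<times> Q)"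
  by (intro separately_holomorphic_mult sep)

text \<open>The algebraic core of the next lemma, with \<open>i\<close> for \<open>1 / q\<close> and
  \<open>j\<close> for \<open>1 / F\<close> so that it becomes a polynomial identity modulo two
  relations. Here \<open>X\<close>, \<open>Y\<close> are the partial derivatives of
  \<open>F\<close>, \<open>m\<close> is the cross term of the two other forms, and \<open>s\<close>,
  \<open>t\<close> are the \<open>\<sigma>\<close> and \<open>\<tau>\<close> of the first.\<close>

lemma eta_identity:
  fixes q i F j :: complex
  assumes "q * i = 1" "F * j = 1"
  shows "- (X * m * t + F * (m * (t * a + s * c)) + m * s * (Y * q - F)) * i\<^sup>2 =
    (a + X * j) * (- (F * m * t * i\<^sup>2)) - ((c - 1) * i + Y * j) * (F * m * s * i)"
  using assms by algebra

text \<open>\<open>a\<close>, \<open>c\<close> and \<open>F\<close> enter through equations rather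
  than as terms: rotating \<open>r\<close>, \<open>s\<close>, \<open>t\<close> then leaves the
  one-form on the right unchanged, and the same statement yields all three defining equations of
  \<open>eta\<close>.\<close>

lemma eta_equation:
  assumes I: "r \<in> I" "s \<in> I" "t \<in> I" "r \<noteq> s" "s \<noteq> t" "t \<noteq> r" and z: "z \<in> P \<times> Q"
    and a: "a = eta1 r s t (fst z)" and c: "c = eta2 r s t (fst z)"
    and F: "\<And>u. F u = factor r s t u"
  shows "ext_d (fmult (wedge (w s) (w t)) (w r)) z =
    wedge (\<lambda>_. (a + d1 F z / F z, (c - 1) / snd z + d2 F z / F z)) (fmult (wedge (w s) (w t)) (w r)) z"
proof -
  have F_eq: "F = factor r s t" using F by auto
  define p q where pq: "p = fst z" "q = snd z"
  have p: "p \<in> P" and q: "q \<in> Q" and zpq: "z = (p, q)" using z pq by auto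
  have qnz: "q \<noteq> 0" using q Q_nz by auto
  have Fnz: "F z \<noteq> 0" using I z g_nz by (simp add: F)
  have fsep: "separately_holomorphic_on F (P \<times> Q)" unfolding F_eq by (rule factor_sep) (use I in auto)
  have form: "fmult (wedge (w s) (w t)) (w r) u =
      (F u * cross s t (fst u) * \<sigma> r (fst u) / snd u, - (F u * cross s t (fst u) * \<tau> r / (snd u)\<^sup>2))"
    if "u \<in> P \<times> Q" for u
    using I that Q_nz by (auto simp: fmult_def wedge_w w_eq F power2_eq_square)
  have "((\<lambda>x. F (x, q) * cross s t x) has_field_derivative
      d1 F z * cross s t p + F z * (deriv (\<sigma> t) p * \<tau> s - deriv (\<sigma> s) p * \<tau> t)) (at p)"
    using d1_deriv[OF fsep z] cross_deriv[OF I(2,3) p]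
    by (auto intro!: derivative_eq_intros simp: zpq)
  from DERIV_cmult_right[OF this, of "- (\<tau> r / q\<^sup>2)"]
  have "((\<lambda>x. - (F (x, q) * cross s t x * \<tau> r / q\<^sup>2)) has_field_derivative
      - ((d1 F z * cross s t p + F z * (deriv (\<sigma> t) p * \<tau> s - deriv (\<sigma> s) p * \<tau> t)) * \<tau> r / q\<^sup>2)) (at p)"
    by simp
  moreover have "\<forall>\<^sub>F x in nhds p. - (F (x, q) * cross s t x * \<tau> r / q\<^sup>2) =
      snd (fmult (wedge (w s) (w t)) (w r) (x, q))"
    using eventually_P[OF p] by eventually_elim (use form q in auto)
  ultimately have 1: "d1 (\<lambda>u. snd (fmult (wedge (w s) (w t)) (w r) u)) z =
      - ((d1 F z * cross s t p + F z * (deriv (\<sigma> t) p * \<tau> s - deriv (\<sigma> s) p * \<tau> t)) * \<tau> r / q\<^sup>2)"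
    by (intro d1_eqI) (simp add: zpq DERIV_cong_ev)
  have "((\<lambda>y. F (p, y) * cross s t p * \<sigma> r p / y) has_field_derivative
      cross s t p * \<sigma> r p * (d2 F z * q - F z) / q\<^sup>2) (at q)"
    using d2_deriv[OF fsep z] qnz
    by (auto intro!: derivative_eq_intros simp: zpq power2_eq_square algebra_simps)
  moreover have "\<forall>\<^sub>F y in nhds q. F (p, y) * cross s t p * \<sigma> r p / y =
      fst (fmult (wedge (w s) (w t)) (w r) (p, y))"
    using eventually_Q[OF q] by eventually_elim (use form p in auto)
  ultimately have 2: "d2 (\<lambda>u. fst (fmult (wedge (w s) (w t)) (w r) u)) z =
      cross s t p * \<sigma> r p * (d2 F z * q - F z) / q\<^sup>2"
    by (intro d2_eqI) (simp add: zpq DERIV_cong_ev)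
  have eq: "\<tau> r * (deriv (\<sigma> t) p * \<tau> s - deriv (\<sigma> s) p * \<tau> t) = cross s t p * (\<tau> r * a + \<sigma> r p * c)"
    unfolding a c pq(1)[symmetric] by (rule eta12_equation) (use I p cross_nz in auto)
  have "ext_d (fmult (wedge (w s) (w t)) (w r)) z =
     - (d1 F z * cross s t p * \<tau> r + F z * (\<tau> r * (deriv (\<sigma> t) p * \<tau> s - deriv (\<sigma> s) p * \<tau> t))
        + cross s t p * \<sigma> r p * (d2 F z * q - F z)) / q\<^sup>2"
    unfolding ext_d_def 1 2 by (simp add: algebra_simps diff_divide_distrib add_divide_distrib)
  also have "\<dots> = wedge (\<lambda>_. (a + d1 F z / F z, (c - 1) / q + d2 F z / F z))
      (fmult (wedge (w s) (w t)) (w r)) z"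
    unfolding wedge_def[of _ "fmult _ _"] form[OF z] eq pq[symmetric] fst_conv snd_conv
      divide_inverse power_inverse[symmetric]
    by (rule eta_identity) (use qnz Fnz in simp_all)
  finally show ?thesis unfolding pq .
qed

lemma eta_eq:
  assumes I: "r \<in> I" "s \<in> I" "t \<in> I" "r \<noteq> s" "s \<noteq> t" "t \<noteq> r" and z: "z \<in> P \<times> Q"
  shows "eta (w r) (w s) (w t) z =
    (eta1 r s t (fst z) + d1 (factor r s t) z / factor r s t z,
     (eta2 r s t (fst z) - 1) / snd z + d2 (factor r s t) z / factor r s t z)"
proof -
  have wnz: "wedge (w i) (w j) z \<noteq> 0" if "i \<in> I" "j \<in> I" "i \<noteq> j" for i j
    using that z Q_nz g_nz cross_nz by (auto simp: wedge_w)
  show ?thesis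
    by (rule eta_eqI; (rule wnz eta_equation)?)
       (use I z in \<open>auto simp: eta1_rotate eta2_rotate algebra_simps\<close>)
qed

lemma eta2_holomorphic:
  assumes I: "r \<in> I" "s \<in> I" "t \<in> I" "r \<noteq> s" "s \<noteq> t" "t \<noteq> r"
  shows "eta2 r s t holomorphic_on P"
  unfolding eta2_def[abs_def] cross_def
  using I by (intro holomorphic_intros holo holomorphic_deriv open_P) (use transverse in auto)

text \<open>The logarithmic differential of the factor contributes a symmetric second derivative to both
  terms.\<close>

lemma eta_derivs:
  assumes I: "r \<in> I" "s \<in> I" "t \<in> I" "r \<noteq> s" "s \<noteq> t" "t \<noteq> r" and p: "p \<in> P" and q: "q \<in> Q"
  obtains A where
    "((\<lambda>x. snd (eta (w r) (w s) (w t) (x, q))) has_field_derivative deriv (eta2 r s t) p / q + A) (at p)"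
    "((\<lambda>y. fst (eta (w r) (w s) (w t) (p, y))) has_field_derivative A) (at q)"
proof -
  define F where "F = factor r s t"
  have qnz: "q \<noteq> 0" using q Q_nz by auto
  have z: "(p, q) \<in> P \<times> Q" using p q by simp
  have Fnz: "F (p, q) \<noteq> 0" using I z g_nz by (simp add: F_def)
  have F: "separately_holomorphic_on F (P \<times> Q)" unfolding F_def by (rule factor_sep) (use I in auto)
  note F1 = separately_holomorphic_d1[OF F open_PQ] and F2 = separately_holomorphic_d2[OF F open_PQ]
  define A where "A = (d1 (d2 F) (p, q) * F (p, q) - d1 F (p, q) * d2 F (p, q)) / (F (p, q))\<^sup>2"
  have "(eta2 r s t has_field_derivative deriv (eta2 r s t) p) (at p)"
    using eta2_holomorphic[OF I] open_P p by (rule holomorphic_derivI)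
  then have 1: "((\<lambda>x. (eta2 r s t x - 1) / q + d2 F (x, q) / F (x, q)) has_field_derivative
      deriv (eta2 r s t) p / q + A) (at p)"
    using d1_deriv[OF F z] d1_deriv[OF F2 z] qnz Fnz
    by (auto intro!: derivative_eq_intros simp: A_def power2_eq_square algebra_simps)
  have "\<forall>\<^sub>F x in nhds p. (eta2 r s t x - 1) / q + d2 F (x, q) / F (x, q) =
      snd (eta (w r) (w s) (w t) (x, q))"
    using eventually_P[OF p] by eventually_elim (use q in \<open>simp add: eta_eq I F_def\<close>)
  with 1 have 1: "((\<lambda>x. snd (eta (w r) (w s) (w t) (x, q))) has_field_derivative
      deriv (eta2 r s t) p / q + A) (at p)"
    by (simp add: DERIV_cong_ev)
  have 2: "((\<lambda>y. eta1 r s t p + d1 F (p, y) / F (p, y)) has_field_derivative A) (at q)"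
    using d2_deriv[OF F z] d2_deriv[OF F1 z] Fnz d1_d2_commute[OF F open_PQ z]
    by (auto intro!: derivative_eq_intros simp: A_def power2_eq_square algebra_simps)
  have "\<forall>\<^sub>F y in nhds q. eta1 r s t p + d1 F (p, y) / F (p, y) =
      fst (eta (w r) (w s) (w t) (p, y))"
    using eventually_Q[OF q] by eventually_elim (use p in \<open>simp add: eta_eq I F_def\<close>)
  with 2 have "((\<lambda>y. fst (eta (w r) (w s) (w t) (p, y))) has_field_derivative A) (at q)"
    by (simp add: DERIV_cong_ev)
  with 1 show ?thesis by (rule that)
qed

end

lemma finite_triples:
  assumes "finite I"
  shows "finite {(r, s, t). r \<in> I \<and> s \<in> I \<and> t \<in> I \<and> R r s t}"
  by (rule finite_subset[of _ "I \<times> I \<times> I"]) (use assms in auto)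

text \<open>In the differential of \<open>eta\<close> the second derivatives \<open>A\<close>
  cancel, \<open>eta1\<close> disappears because it does not depend on \<open>q\<close>, and so does
  \<open>- dq / q\<close>. What remains no longer contains the factors \<open>g\<close>.\<close>

lemma (in invariant_forms) forms_curvature_eq:
  assumes I: "I = {..<k}" and z: "z \<in> P \<times> Q"
  shows "forms_curvature k w z =
    (\<Sum>(r, s, t) \<in> {(r, s, t). r < s \<and> s < t \<and> t < k}. deriv (eta2 r s t) (fst z)) / snd z"
proof -
  define T where "T = {(r, s, t). r < s \<and> s < t \<and> t < k}"
  obtain p q where zpq: "z = (p, q)" and p: "p \<in> P" and q: "q \<in> Q" using z by auto
  have "\<exists>A. ((\<lambda>x. snd (eta (w r) (w s) (w t) (x, q))) has_field_derivative deriv (eta2 r s t) p / q + A) (at p)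
    \<and> ((\<lambda>y. fst (eta (w r) (w s) (w t) (p, y))) has_field_derivative A) (at q)"
    if "(r, s, t) \<in> T" for r s t
    using eta_derivs[of r s t p q] that p q I unfolding T_def by auto
  then obtain A where
    A: "\<And>r s t. (r, s, t) \<in> T \<Longrightarrow> ((\<lambda>x. snd (eta (w r) (w s) (w t) (x, q))) has_field_derivative
          deriv (eta2 r s t) p / q + A r s t) (at p)"
       "\<And>r s t. (r, s, t) \<in> T \<Longrightarrow> ((\<lambda>y. fst (eta (w r) (w s) (w t) (p, y))) has_field_derivative A r s t) (at q)"
    by metis
  have 1: "((\<lambda>x. \<Sum>(r, s, t)\<in>T. snd (eta (w r) (w s) (w t) (x, q))) has_field_derivative
      (\<Sum>(r, s, t)\<in>T. deriv (eta2 r s t) p / q + A r s t)) (at p)"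
    by (rule DERIV_sum) (use A in auto)
  have 2: "((\<lambda>y. \<Sum>(r, s, t)\<in>T. fst (eta (w r) (w s) (w t) (p, y))) has_field_derivative
      (\<Sum>(r, s, t)\<in>T. A r s t)) (at q)"
    by (rule DERIV_sum) (use A in auto)
  have "forms_curvature k w z =
      (\<Sum>(r, s, t)\<in>T. deriv (eta2 r s t) p / q + A r s t) - (\<Sum>(r, s, t)\<in>T. A r s t)"
    unfolding forms_curvature_def ext_d_def T_def[symmetric] zpq
    by (intro arg_cong2[where f = "(-)"] d1_eqI d2_eqI)
       (use 1 2 in \<open>simp_all add: fst_sum snd_sum case_prod_unfold\<close>)
  also have "\<dots> = (\<Sum>(r, s, t)\<in>T. deriv (eta2 r s t) p) / q"
    by (simp add: sum.distrib case_prod_unfold sum_divide_distrib)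
  finally show ?thesis by (simp add: T_def zpq)
qed

section \<open>Sums over triples, freed from the numbering\<close>

definition distinct_triples :: "nat set \<Rightarrow> (nat \<times> nat \<times> nat) set" where
  "distinct_triples I = {(r, s, t). r \<in> I \<and> s \<in> I \<and> t \<in> I \<and> r \<noteq> s \<and> s \<noteq> t \<and> t \<noteq> r}"

lemma finite_distinct_triples: "finite I \<Longrightarrow> finite (distinct_triples I)"
  unfolding distinct_triples_def by (rule finite_triples)

text \<open>Increasing triples are not preserved by a renumbering of the foliations, but triples of
  distinct indices are. For symmetric \<open>f\<close> the six orderings of a triple contribute
  equally.\<close>

lemma sum_ordered_triples:
  fixes f :: "nat \<Rightarrow> nat \<Rightarrow> nat \<Rightarrow> complex"
  assumes rot: "\<And>r s t. f s t r = f r s t" and swap: "\<And>r s t. f s r t = f r s t"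
  shows "6 * (\<Sum>(r, s, t) \<in> {(r, s, t). r < s \<and> s < t \<and> t < k}. f r s t)
    = (\<Sum>(r, s, t) \<in> distinct_triples {..<k}. f r s t)"
proof -
  let ?S = "\<lambda>A. \<Sum>(r, s, t)\<in>A. f r s t"
  define T where "T = {(r, s, t). r < s \<and> s < t \<and> t < k}"
  define T2 where "T2 = {(s, t, r). r < s \<and> s < t \<and> t < k}"
  define T3 where "T3 = {(t, r, s). r < s \<and> s < t \<and> t < k}"
  define T4 where "T4 = {(s, r, t). r < s \<and> s < t \<and> t < k}"
  define T5 where "T5 = {(r, t, s). r < s \<and> s < t \<and> t < k}"
  define T6 where "T6 = {(t, s, r). r < s \<and> s < t \<and> t < k}"
  note defs = T_def T2_def T3_def T4_def T5_def T6_def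
  have fin: "finite T" "finite T2" "finite T3" "finite T4" "finite T5" "finite T6"
    unfolding defs by (rule finite_subset[of _ "{..<k} \<times> {..<k} \<times> {..<k}"]; auto)+
  have un: "distinct_triples {..<k} = T \<union> (T2 \<union> (T3 \<union> (T4 \<union> (T5 \<union> T6))))"
    unfolding defs distinct_triples_def by auto
  have S2: "?S T2 = ?S T"
    by (rule sum.reindex_bij_witness[of _ "\<lambda>(r, s, t). (s, t, r)" "\<lambda>(s, t, r). (r, s, t)"])
       (auto simp: defs rot)
  have S3: "?S T3 = ?S T"
    by (rule sum.reindex_bij_witness[of _ "\<lambda>(r, s, t). (t, r, s)" "\<lambda>(t, r, s). (r, s, t)"])
       (auto simp: defs rot)
  have S4: "?S T4 = ?S T"
    by (rule sum.reindex_bij_witness[of _ "\<lambda>(r, s, t). (s, r, t)" "\<lambda>(s, r, t). (r, s, t)"])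
       (auto simp: defs swap)
  have "f r t s = f r s t" "f t s r = f r s t" for r s t
    using rot swap by metis+
  then have S5: "?S T5 = ?S T" and S6: "?S T6 = ?S T"
    by (rule_tac [!] sum.reindex_bij_witness[of _ "\<lambda>(r, s, t). (r, t, s)" "\<lambda>(r, t, s). (r, s, t)"]
         sum.reindex_bij_witness[of _ "\<lambda>(r, s, t). (t, s, r)" "\<lambda>(t, s, r). (r, s, t)"];
        force simp: defs)+
  have "?S (distinct_triples {..<k}) = ?S T + (?S T2 + (?S T3 + (?S T4 + (?S T5 + ?S T6))))"
  proof -
    have "T \<inter> (T2 \<union> (T3 \<union> (T4 \<union> (T5 \<union> T6)))) = {}" "T2 \<inter> (T3 \<union> (T4 \<union> (T5 \<union> T6))) = {}"
      "T3 \<inter> (T4 \<union> (T5 \<union> T6)) = {}" "T4 \<inter> (T5 \<union> T6) = {}" "T5 \<inter> T6 = {}"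
      unfolding defs by auto
    then show ?thesis unfolding un using fin by (simp add: sum.union_disjoint)
  qed
  also have "\<dots> = 6 * ?S T" unfolding S2 S3 S4 S5 S6 by simp
  finally show ?thesis unfolding T_def by simp
qed

context invariant_forms
begin

text \<open>\<open>cross\<close> is antisymmetric, so the exchange changes the sign of both the
  numerator and the denominator.\<close>

lemma eta2_swap: "eta2 s r t p = eta2 r s t p"
proof -
  have c: "cross j i p = - cross i j p" for i j by (simp add: cross_def)
  show ?thesis
    unfolding eta2_def c[of s r] c[of r t] c[of t s] by (simp add: algebra_simps add_divide_distrib diff_divide_distrib)
qed

lemma forms_curvature_distinct:
  assumes I: "I = {..<k}" and z: "z \<in> P \<times> Q"
  shows "6 * snd z * forms_curvature k w z = (\<Sum>(r, s, t) \<in> distinct_triples I. deriv (eta2 r s t) (fst z))"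
proof -
  have "eta2 s t r = eta2 r s t" "eta2 s r t = eta2 r s t" for r s t
    using eta2_rotate eta2_swap by auto
  then have "6 * (\<Sum>(r, s, t) \<in> {(r, s, t). r < s \<and> s < t \<and> t < k}. deriv (eta2 r s t) (fst z))
    = (\<Sum>(r, s, t) \<in> distinct_triples {..<k}. deriv (eta2 r s t) (fst z))"
    by (intro sum_ordered_triples) auto
  moreover have "snd z \<noteq> 0" using z Q_nz by auto
  ultimately show ?thesis
    unfolding forms_curvature_eq[OF assms] I by simp
qed

end

text \<open>The index \<open>i0\<close> stands for \<open>dp\<close>; by \<open>\<tau> = 0\<close> the function \<open>eta2\<close> vanishes on every triple that
  contains it.\<close>

lemma forms_curvature_add_fibration:
  assumes w: "invariant_forms P Q {..<n} w g \<sigma> (\<lambda>_. 1)"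
    and w': "invariant_forms P Q {..<d} w' g' \<sigma>' (\<lambda>i. if i = i0 then 0 else 1)"
    and i0: "i0 < d" and z: "z \<in> P \<times> Q"
    and eq: "\<And>p. p \<in> P \<Longrightarrow> (\<lambda>i. \<sigma> i p) ` {..<n} = (\<lambda>j. \<sigma>' j p) ` ({..<d} - {i0})"
  shows "forms_curvature d w' z = forms_curvature n w z"
proof -
  interpret W: invariant_forms P Q "{..<n}" w g \<sigma> "\<lambda>_. 1" by (rule w)
  interpret W': invariant_forms P Q "{..<d}" w' g' \<sigma>' "\<lambda>i. if i = i0 then 0 else 1" by (rule w')
  define J where "J = {..<d} - {i0}"
  obtain p q where zpq: "z = (p, q)" and p: "p \<in> P" and q: "q \<in> Q" using z by auto
  have qnz: "q \<noteq> 0" using q W.Q_nz by auto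
  have inj: "inj_on (\<lambda>i. \<sigma> i x) {..<n}" if "x \<in> P" for x
    using W.transverse[OF _ _ _ that] by (auto simp: inj_on_def)
  have inj': "inj_on (\<lambda>j. \<sigma>' j x) J" if "x \<in> P" for x
    using W'.transverse[OF _ _ _ that] by (force simp: inj_on_def J_def)
  \<comment> \<open>The two families are numbered independently; \<open>\<rho>\<close> pairs indices
    whose slopes agree at the single point \<open>p\<close>.\<close>
  define \<rho> where "\<rho> = inv_into {..<n} (\<lambda>i. \<sigma> i p) \<circ> (\<lambda>j. \<sigma>' j p)"
  have bij: "bij_betw \<rho> J {..<n}"
    unfolding \<rho>_def
  proof (rule bij_betw_trans)
    show "bij_betw (\<lambda>j. \<sigma>' j p) J ((\<lambda>i. \<sigma> i p) ` {..<n})"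
      using inj'[OF p] eq[OF p] by (simp add: bij_betw_def J_def)
    show "bij_betw (inv_into {..<n} (\<lambda>i. \<sigma> i p)) ((\<lambda>i. \<sigma> i p) ` {..<n}) {..<n}"
      by (intro bij_betw_inv_into inj_on_imp_bij_betw inj p)
  qed
  have \<rho>_lt: "\<rho> j < n" if "j \<in> J" for j using bij_betwE[OF bij] that by auto
  have \<rho>_eq: "\<sigma> (\<rho> j) p = \<sigma>' j p" if "j \<in> J" for j
  proof -
    have "\<sigma>' j p \<in> (\<lambda>i. \<sigma> i p) ` {..<n}" using that eq[OF p] by (simp add: J_def)
    from f_inv_into_f[OF this] show ?thesis by (simp add: \<rho>_def)
  qed
  \<comment> \<open>The pairing chosen at \<open>p\<close> persists nearby: the value of
    \<open>\<sigma>' j\<close> is always one of the finitely many \<open>\<sigma> i\<close>, and by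
    continuity those with \<open>i\<close> different from \<open>\<rho> j\<close> stay away from it.
    Agreement near \<open>p\<close> is needed because derivatives are compared.\<close>
  have "eventually (\<lambda>x. \<sigma> (\<rho> j) x = \<sigma>' j x) (nhds p)" if j: "j \<in> J" for j
  proof -
    have cont: "isCont (\<sigma> i) p" if "i < n" for i
      using W.deriv_sigma[of i p] that p DERIV_isCont by blast
    have cont': "isCont (\<sigma>' j) p"
      using W'.deriv_sigma[of j p] j p DERIV_isCont by (force simp: J_def)
    have "eventually (\<lambda>x. \<sigma> i x \<noteq> \<sigma>' j x) (nhds p)" if i: "i < n" "i \<noteq> \<rho> j" for i
    proof -
      have "\<sigma> i p \<noteq> \<sigma> (\<rho> j) p"
        using inj[OF p] i \<rho>_lt[OF j] by (auto simp: inj_on_def)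
      then have "\<sigma> i p - \<sigma>' j p \<noteq> 0" using \<rho>_eq[OF j] by simp
      moreover have "isCont (\<lambda>x. \<sigma> i x - \<sigma>' j x) p"
        using cont[OF i(1)] cont' by (intro continuous_intros)
      ultimately have "eventually (\<lambda>x. \<sigma> i x - \<sigma>' j x \<noteq> 0) (nhds p)"
        using tendsto_at_iff_tendsto_nhds[of "\<lambda>x. \<sigma> i x - \<sigma>' j x" p]
        unfolding isCont_def by (intro tendsto_imp_eventually_ne) auto
      then show ?thesis by eventually_elim simp
    qed
    then have "eventually (\<lambda>x. \<forall>i\<in>{..<n} - {\<rho> j}. \<sigma> i x \<noteq> \<sigma>' j x) (nhds p)"
      by (intro eventually_ball_finite) auto
    then show ?thesis using W.eventually_P[OF p]
    proof eventually_elim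
      case (elim x)
      have "\<sigma>' j x \<in> (\<lambda>i. \<sigma> i x) ` {..<n}"
        using eq[OF elim(2)] j by (auto simp: J_def)
      then show ?case using elim(1) by auto
    qed
  qed
  then have "eventually (\<lambda>x. \<forall>j\<in>J. \<sigma> (\<rho> j) x = \<sigma>' j x) (nhds p)"
    by (intro eventually_ball_finite) (auto simp: J_def)
  then obtain N where N: "open N" "p \<in> N" and N_eq: "\<And>j x. j \<in> J \<Longrightarrow> x \<in> N \<Longrightarrow> \<sigma> (\<rho> j) x = \<sigma>' j x"
    unfolding eventually_nhds by blast
  have N_deriv: "deriv (\<sigma> (\<rho> j)) x = deriv (\<sigma>' j) x" if "j \<in> J" "x \<in> N" for j x
  proof (rule deriv_cong_ev)
    show "\<forall>\<^sub>F x in nhds x. \<sigma> (\<rho> j) x = \<sigma>' j x"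
      using eventually_nhds_in_open[OF N(1) that(2)] by eventually_elim (rule N_eq[OF that(1)])
  qed simp
  have N_eta: "W'.eta2 r s t x = W.eta2 (\<rho> r) (\<rho> s) (\<rho> t) x"
    if "r \<in> J" "s \<in> J" "t \<in> J" "x \<in> N" for r s t x
  proof -
    have "r \<noteq> i0" "s \<noteq> i0" "t \<noteq> i0" using that by (auto simp: J_def)
    then show ?thesis
      using that by (simp add: W.eta2_def W'.eta2_def W.cross_def W'.cross_def N_deriv N_eq)
  qed
  have K: "deriv (W'.eta2 r s t) p = deriv (W.eta2 (\<rho> r) (\<rho> s) (\<rho> t)) p"
    if "r \<in> J" "s \<in> J" "t \<in> J" for r s t
  proof (rule deriv_cong_ev)
    show "\<forall>\<^sub>F x in nhds p. W'.eta2 r s t x = W.eta2 (\<rho> r) (\<rho> s) (\<rho> t) x"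
      using eventually_nhds_in_open[OF N] by eventually_elim (rule N_eta[OF that])
  qed simp
  have K0: "deriv (W'.eta2 r s t) p = 0" if "r = i0 \<or> s = i0 \<or> t = i0" for r s t
  proof -
    have "W'.eta2 r s t = (\<lambda>_. 0)" using that by (auto simp: W'.eta2_def)
    then show ?thesis by simp
  qed
  have "(\<Sum>(r, s, t) \<in> distinct_triples {..<d}. deriv (W'.eta2 r s t) p) =
     (\<Sum>(r, s, t) \<in> distinct_triples J. deriv (W'.eta2 r s t) p)"
    using K0 by (intro sum.mono_neutral_right finite_distinct_triples)
      (auto simp: distinct_triples_def J_def)
  also have "\<dots> = (\<Sum>x \<in> distinct_triples J. (\<lambda>(r, s, t). deriv (W.eta2 r s t) p)
      (map_prod \<rho> (map_prod \<rho> \<rho>) x))"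
    using K by (intro sum.cong) (auto simp: distinct_triples_def)
  also have "\<dots> = (\<Sum>(r, s, t) \<in> distinct_triples {..<n}. deriv (W.eta2 r s t) p)"
  proof (rule sum.reindex_bij_betw)
    have inj: "inj_on \<rho> J" and im: "\<rho> ` J = {..<n}" using bij by (auto simp: bij_betw_def)
    show "bij_betw (map_prod \<rho> (map_prod \<rho> \<rho>)) (distinct_triples J) (distinct_triples {..<n})"
    proof (rule bij_betw_imageI)
      have "inj_on (map_prod \<rho> (map_prod \<rho> \<rho>)) (J \<times> J \<times> J)"
        by (intro map_prod_inj_on inj)
      then show "inj_on (map_prod \<rho> (map_prod \<rho> \<rho>)) (distinct_triples J)"
        by (rule inj_on_subset) (auto simp: distinct_triples_def)
      show "map_prod \<rho> (map_prod \<rho> \<rho>) ` distinct_triples J = distinct_triples {..<n}"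
      proof (intro equalityI subsetI)
        fix x assume "x \<in> map_prod \<rho> (map_prod \<rho> \<rho>) ` distinct_triples J"
        then obtain r s t where "x = (\<rho> r, \<rho> s, \<rho> t)" "r \<in> J" "s \<in> J" "t \<in> J" "r \<noteq> s" "s \<noteq> t" "t \<noteq> r"
          unfolding distinct_triples_def by force
        then show "x \<in> distinct_triples {..<n}"
          by (simp add: distinct_triples_def \<rho>_lt inj_on_eq_iff[OF inj])
      next
        fix x assume x: "x \<in> distinct_triples {..<n}"
        then obtain r' s' t' where x0: "x = (r', s', t')" "r' \<in> \<rho> ` J" "s' \<in> \<rho> ` J" "t' \<in> \<rho> ` J"
          unfolding im by (auto simp: distinct_triples_def)
        then obtain r s t where x': "x = (\<rho> r, \<rho> s, \<rho> t)" "r \<in> J" "s \<in> J" "t \<in> J"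
          by blast
        with x have "(r, s, t) \<in> distinct_triples J" by (auto simp: distinct_triples_def)
        with x'(1) show "x \<in> map_prod \<rho> (map_prod \<rho> \<rho>) ` distinct_triples J"
          by (intro image_eqI[of _ _ "(r, s, t)"]) auto
      qed
    qed
  qed
  finally have "6 * q * forms_curvature d w' z = 6 * q * forms_curvature n w z"
    using W.forms_curvature_distinct[OF refl z] W'.forms_curvature_distinct[OF refl z] by (simp add: zpq)
  then show ?thesis using qnz by simp
qed

section \<open>Homogeneous foliations\<close>

lemma eval2_mult: "eval2 (P * Q) x y = eval2 P x y * eval2 Q x y"
  by (simp add: eval2_def)

text \<open>Over the coefficient ring of polynomials in \<open>x\<close>, the difference has
  infinitely many roots, namely all constants.\<close>

lemma eval2_eqI:
  assumes "\<And>x y. eval2 P x y = eval2 Q x y"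
  shows "P = Q"
proof -
  have "poly (P - Q) [:y:] = 0" for y
    using assms by (intro poly_ext) (simp add: eval2_def)
  then have "range (\<lambda>y. [:y:]) \<subseteq> {z. poly (P - Q) z = 0}" by auto
  moreover have "infinite (range (\<lambda>y::complex. [:y:]))"
    by (subst finite_image_iff) (auto simp: inj_on_def infinite_UNIV_char_0)
  ultimately have "P - Q = 0" using poly_roots_finite finite_subset by blast
  then show ?thesis by simp
qed

text \<open>Pullback under the homothety of ratio 2, built coefficientwise so that each monomial is
  an eigenvector with eigenvalue 2 to its total degree.\<close>

definition dilate :: "bipoly \<Rightarrow> bipoly" where
  "dilate A = (\<Sum>j\<le>degree A. monom (smult (2 ^ j) (pcompose (coeff A j) [:0, 2:])) j)"

lemma coeff_dilate: "coeff (dilate A) j = smult (2 ^ j) (pcompose (coeff A j) [:0, 2:])"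
proof -
  have "coeff (dilate A) j = (\<Sum>i\<le>degree A. if i = j then smult (2 ^ i) (pcompose (coeff A i) [:0, 2:]) else 0)"
    by (simp add: dilate_def coeff_sum)
  also have "\<dots> = smult (2 ^ j) (pcompose (coeff A j) [:0, 2:])"
    by (auto simp: sum.delta coeff_eq_0)
  finally show ?thesis .
qed

lemma coeff_coeff_dilate: "coeff (coeff (dilate A) j) i = 2 ^ (i + j) * coeff (coeff A j) i"
  by (simp add: coeff_dilate coeff_pcompose_linear power_add)

lemma eval2_dilate: "eval2 (dilate A) x y = eval2 A (2 * x) (2 * y)"
proof -
  have "eval2 (dilate A) x y = (\<Sum>j\<le>degree A. 2 ^ j * poly (coeff A j) (2 * x) * y ^ j)"
    by (simp add: dilate_def eval2_def poly_sum poly_monom poly_pcompose mult.commute mult.left_commute)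
  also have "\<dots> = (\<Sum>j\<le>degree A. poly (coeff A j) (2 * x) * (2 * y) ^ j)"
    by (intro sum.cong refl) (simp only: power_mult_distrib mult.assoc mult.left_commute)
  also have "\<dots> = eval2 A (2 * x) (2 * y)"
    by (simp add: eval2_def poly_altdef[of A] poly_sum)
  finally show ?thesis .
qed

text \<open>Invariance under the single homothety of ratio 2 suffices, as 2 is not a root of unity.\<close>

lemma homogeneous_isobaric:
  assumes cop: "coprime A B" and hom: "homogeneous (A, B)"
  obtains m where "\<And>i j. coeff (coeff A j) i \<noteq> 0 \<Longrightarrow> i + j = m"
    "\<And>i j. coeff (coeff B j) i \<noteq> 0 \<Longrightarrow> i + j = m"
proof -
  \<comment> \<open>\<open>A\<close> and \<open>B\<close> are generalized so that the case
    \<open>A = 0\<close> can be settled by exchanging them.\<close>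
  have main: "\<exists>m. \<forall>i j. (coeff (coeff A j) i \<noteq> 0 \<longrightarrow> i + j = m) \<and> (coeff (coeff B j) i \<noteq> 0 \<longrightarrow> i + j = m)"
    if cop: "coprime A B" and AB: "dilate A * B = dilate B * A" and A: "A \<noteq> 0" for A B :: bipoly
  proof -
    \<comment> \<open>Coprimality makes \<open>A\<close> divide its own dilation. Since dilation
      does not raise the degree in \<open>y\<close>, the quotient is free of
      \<open>y\<close>.\<close>
    have "A dvd dilate A * B" unfolding AB by simp
    then have "A dvd dilate A" using coprime_dvd_mult_left_iff[OF cop] by blast
    then obtain C where C: "dilate A = A * C" by blast
    have nz: "dilate A \<noteq> 0"
    proof
      assume "dilate A = 0"
      then have "coeff (coeff A j) i = 0" for i j using coeff_coeff_dilate[of A j i] by simp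
      then have "A = 0" by (auto intro!: poly_eqI)
      with A show False by simp
    qed
    then have C0: "C \<noteq> 0" using C by auto
    have "degree (dilate A) \<le> degree A"
      by (rule degree_le) (simp add: coeff_dilate coeff_eq_0)
    then have "degree C = 0" using C A C0 by (simp add: degree_mult_eq)
    then obtain c where c: "C = [:c:]" by (rule degree_eq_zeroE)
    have c0: "c \<noteq> 0" using c C0 by simp
    \<comment> \<open>The leading coefficient in \<open>y\<close> keeps its degree in
      \<open>x\<close> under dilation, so the quotient is free of \<open>x\<close> too. It is then a
      common eigenvalue \<open>k\<close> of \<open>A\<close> and \<open>B\<close>, equal to 2 to the
      degree of every monomial that occurs.\<close>
    have "lead_coeff A * c = coeff (dilate A) (degree A)" unfolding C c by simp
    also have "degree \<dots> = degree (lead_coeff A)" by (simp add: coeff_dilate degree_pcompose)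
    finally have "degree (lead_coeff A * c) = degree (lead_coeff A)" .
    then have "degree c = 0" using A c0 by (simp add: degree_mult_eq)
    then obtain k where k: "c = [:k:]" by (rule degree_eq_zeroE)
    have A2: "dilate A = smult [:k:] A" unfolding C c k by simp
    have "A * (smult [:k:] B) = dilate A * B" unfolding A2 mult_smult_left mult_smult_right ..
    also have "\<dots> = A * dilate B" unfolding AB by (rule mult.commute)
    finally have "smult [:k:] B = dilate B" unfolding mult_left_cancel[OF A] .
    then have B2: "dilate B = smult [:k:] B" ..
    have kA: "2 ^ (i + j) = k" if "coeff (coeff A j) i \<noteq> 0" for i j
      using coeff_coeff_dilate[of A j i] that unfolding A2 by simp
    have kB: "2 ^ (i + j) = k" if "coeff (coeff B j) i \<noteq> 0" for i j
      using coeff_coeff_dilate[of B j i] that unfolding B2 by simp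
    have "coeff (lead_coeff A) (degree (lead_coeff A)) \<noteq> 0" using A by simp
    then obtain i0 j0 where "coeff (coeff A j0) i0 \<noteq> 0" by blast
    then have k0: "k = 2 ^ (i0 + j0)" by (rule kA[symmetric])
    have inj: "a = b" if "(2::complex) ^ a = 2 ^ b" for a b
    proof -
      have "(2::real) ^ a = 2 ^ b" using arg_cong[OF that, of norm] by (simp add: norm_power)
      then show ?thesis by simp
    qed
    have "i + j = i0 + j0" if "coeff (coeff A j) i \<noteq> 0" for i j
      by (rule inj) (use kA[OF that] k0 in simp)
    moreover have "i + j = i0 + j0" if "coeff (coeff B j) i \<noteq> 0" for i j
      by (rule inj) (use kB[OF that] k0 in simp)
    ultimately show ?thesis by blast
  qed
  have AB: "dilate A * B = dilate B * A"
  proof (rule eval2_eqI)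
    fix x y
    show "eval2 (dilate A * B) x y = eval2 (dilate B * A) x y"
      unfolding eval2_mult eval2_dilate using hom unfolding homogeneous_def prod.case
      by (metis zero_neq_numeral)
  qed
  show ?thesis
  proof (cases "A = 0")
    case False
    from main[OF cop AB this] show ?thesis using that by auto
  next
    case True
    then have B: "B \<noteq> 0" using cop by auto
    have "coprime B A" using cop by (simp only: coprime_commute)
    from main[OF this AB[symmetric] B] show ?thesis using that by auto
  qed
qed

section \<open>Binary forms and their dehomogenization\<close>

definition binary_form :: "nat \<Rightarrow> complex poly \<Rightarrow> complex \<Rightarrow> complex \<Rightarrow> complex" where
  "binary_form m a x y = (\<Sum>j\<le>m. coeff a j * x ^ (m - j) * y ^ j)"

lemma binary_form_scale: "binary_form m a (l * x) (l * y) = l ^ m * binary_form m a x y"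
  unfolding binary_form_def sum_distrib_left
proof (rule sum.cong[OF refl])
  fix j assume "j \<in> {..m}"
  then have 1: "l ^ (m - j) * l ^ j = l ^ m" by (simp flip: power_add)
  have 2: "coeff a j * (l * x) ^ (m - j) * (l * y) ^ j =
      (l ^ (m - j) * l ^ j) * (coeff a j * x ^ (m - j) * y ^ j)"
    by (simp only: power_mult_distrib mult_ac)
  show "coeff a j * (l * x) ^ (m - j) * (l * y) ^ j = l ^ m * (coeff a j * x ^ (m - j) * y ^ j)"
    unfolding 2 1 ..
qed

lemma binary_form_1: "degree a \<le> m \<Longrightarrow> binary_form m a 1 u = poly a u"
  using arg_cong[OF poly_as_sum_of_monoms'[of a m], of "\<lambda>c. poly c u"]
  by (simp add: binary_form_def poly_sum poly_monom)

text \<open>Off \<open>x = 0\<close> the binary form is \<open>x^m\<close> times \<open>a\<close> at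
  the slope \<open>y / x\<close>. Its definition avoids the division because \<open>x = 0\<close>
  matters as well: if \<open>m\<close> exceeds the degree of \<open>a\<close>, the form vanishes on
  that line.\<close>

lemma binary_form_slope: "degree a \<le> m \<Longrightarrow> binary_form m a x (x * u) = x ^ m * poly a u"
  using binary_form_scale[of m a x 1 u] by (simp add: binary_form_1)

lemma binary_form_0: "binary_form m a 0 y = coeff a m * y ^ m"
proof -
  have "binary_form m a 0 y = (\<Sum>j\<le>m. if j = m then coeff a m * y ^ m else 0)"
    unfolding binary_form_def by (intro sum.cong) (auto simp: power_0_left)
  then show ?thesis by simp
qed

definition homogenization :: "nat \<Rightarrow> complex poly \<Rightarrow> bipoly" where
  "homogenization m a = (\<Sum>j\<le>m. monom (monom (coeff a j) (m - j)) j)"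

lemma poly_homogenization: "poly (homogenization m a) Y = (\<Sum>j\<le>m. monom (coeff a j) (m - j) * Y ^ j)"
  by (simp add: homogenization_def poly_sum poly_monom)

lemma poly_poly_homogenization: "poly (poly (homogenization m a) Y) x = binary_form m a x (poly Y x)"
  by (simp add: poly_homogenization poly_sum poly_monom binary_form_def)

lemma isobaric_homogenization:
  assumes "\<And>i j. coeff (coeff A j) i \<noteq> 0 \<Longrightarrow> i + j = m"
  obtains a where "degree a \<le> m" "A = homogenization m a"
proof -
  define a where "a = (\<Sum>j\<le>m. monom (coeff (coeff A j) (m - j)) j)"
  have ca: "coeff a j = (if j \<le> m then coeff (coeff A j) (m - j) else 0)" for j
    by (simp add: a_def coeff_sum)
  have "coeff (coeff A j) i = coeff (coeff (homogenization m a) j) i" for i j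
  proof -
    have "coeff (homogenization m a) j = (if j \<le> m then monom (coeff a j) (m - j) else 0)"
      by (simp add: homogenization_def coeff_sum)
    then show ?thesis using assms[of j i] by (cases "coeff (coeff A j) i = 0") (auto simp: ca)
  qed
  then have "A = homogenization m a" by (intro poly_eqI)
  moreover have "degree a \<le> m" by (rule degree_le) (simp add: ca)
  ultimately show ?thesis using that by blast
qed

text \<open>A common root \<open>u\<close> would give the common factor
  \<open>y - u x\<close>.\<close>

lemma coprime_homogenization_no_common_root:
  assumes "coprime (homogenization m a) (homogenization m b)" "degree a \<le> m" "degree b \<le> m"
  shows "\<not> (poly a u = 0 \<and> poly b u = 0)"
proof
  assume u: "poly a u = 0 \<and> poly b u = 0"
  have "[:- [:0, u:], 1:] dvd homogenization m c" if "degree c \<le> m" "poly c u = 0" for c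
    unfolding poly_eq_0_iff_dvd[symmetric] using that
    by (intro poly_ext) (simp add: poly_poly_homogenization binary_form_slope)
  then have "is_unit [:- [:0, u:], 1:]"
    using coprime_common_divisor[OF assms(1)] u assms(2,3) by blast
  then show False by (auto simp: is_unit_poly_iff)
qed

text \<open>If both coefficients vanished, \<open>x\<close> would be a common factor; this is the
  root at infinity missed by the previous lemma.\<close>

lemma coprime_homogenization_lead:
  assumes "coprime (homogenization m a) (homogenization m b)"
  shows "coeff a m \<noteq> 0 \<or> coeff b m \<noteq> 0"
proof (rule ccontr)
  assume u: "\<not> ?thesis"
  have "[:[:0, 1:]:] dvd homogenization m c" if "coeff c m = 0" for c
  proof -
    have "[:- 0, 1:] dvd (if j \<le> m then monom (coeff c j) (m - j) else 0)" for j
      unfolding poly_eq_0_iff_dvd[symmetric] using that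
      by (cases "j = m") (auto simp: poly_monom)
    then show ?thesis
      by (simp add: const_poly_dvd_iff homogenization_def coeff_sum)
  qed
  then have "is_unit [:[:0, 1:] :: complex poly:]"
    using coprime_common_divisor[OF assms] u by blast
  then show False by (auto simp: is_unit_const_poly_iff is_unit_poly_iff)
qed

lemma tangency_homogenization:
  "poly (tangency (homogenization m a, homogenization m b) (p, q)) x =
    binary_form m (a + smult p b) x (p * x - q)"
  by (simp add: tangency_def poly_poly_homogenization binary_form_def sum_distrib_left
      sum.distrib algebra_simps)

lemma coeff_linear_pow: "degree ([:c, e:] ^ j) \<le> j \<and> coeff ([:c, e:] ^ j) j = (e :: complex) ^ j"
proof (induction j)
  case (Suc j)
  then have "coeff ([:c, e:] ^ j) (Suc j) = 0" by (intro coeff_eq_0) simp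
  moreover have "degree ([:c, e:] * [:c, e:] ^ j) \<le> Suc j"
    using Suc degree_mult_le[of "[:c, e:]" "[:c, e:] ^ j"] by (simp split: if_splits)
  ultimately show ?case using Suc by (simp add: coeff_pCons)
qed simp

text \<open>The top coefficient is the dehomogenization of \<open>x A + y B\<close>, evaluated at
  the slope \<open>p\<close> of the line. It vanishes identically precisely when the form is
  proportional to \<open>y dx - x dy\<close>; otherwise the degree is \<open>m\<close> for all but
  finitely many \<open>p\<close>.\<close>

lemma degree_tangency_homogenization:
  fixes a b :: "complex poly" and p q :: complex and m :: nat
  defines "T \<equiv> tangency (homogenization m a, homogenization m b) (p, q)"
  assumes "degree a \<le> m" "degree b \<le> m"
  shows "degree T \<le> m" and "coeff T m = poly (a + [:0, 1:] * b) p"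
proof -
  have deg: "degree (monom c (m - j) * [:-q, p:] ^ j) \<le> m" if "j \<le> m" for c j
  proof -
    have "degree (monom c (m - j) * [:-q, p:] ^ j) \<le> degree (monom c (m - j)) + degree ([:-q, p:] ^ j)"
      by (rule degree_mult_le)
    also have "\<dots> \<le> (m - j) + j" using coeff_linear_pow by (intro add_mono degree_monom_le) auto
    finally show ?thesis using that by simp
  qed
  have deg': "degree (poly (homogenization m c) [:-q, p:]) \<le> m" for c
    unfolding poly_homogenization using deg by (intro degree_sum_le) auto
  have "degree (smult p (poly (homogenization m b) [:-q, p:])) \<le> m"
    using deg'[of b] degree_smult_le le_trans by blast
  then show "degree T \<le> m"
    unfolding T_def tangency_def using deg' by (simp add: degree_add_le)
  have "coeff (monom c (m - j) * [:-q, p:] ^ j) m = c * p ^ j" if "j \<le> m" for c j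
    using that coeff_linear_pow[of "-q" p j] by (simp add: coeff_monom_mult)
  then have "coeff (poly (homogenization m c) [:-q, p:]) m = poly c p" if "degree c \<le> m" for c
    using binary_form_1[OF that, of p] by (simp add: poly_homogenization coeff_sum binary_form_def)
  then show "coeff T m = poly (a + [:0, 1:] * b) p"
    using assms by (simp add: T_def tangency_def)
qed

lemma generically_avoid_finite:
  assumes "generically P" "finite S"
  obtains p q where "p \<notin> S" "P (p, q)"
proof -
  obtain U where U: "open U" "closure U = UNIV" "\<forall>z\<in>U. P z" using assms unfolding generically_def by blast
  have "open ((- S) \<times> (UNIV :: complex set))"
    using assms by (intro open_Times) (auto intro: finite_imp_closed)
  moreover have "(- S) \<times> (UNIV :: complex set) \<noteq> {}"
    using assms(2) ex_new_if_finite[OF infinite_UNIV_char_0] by auto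
  ultimately have "U \<inter> (- S) \<times> UNIV \<noteq> {}"
    using U by (metis Int_UNIV_right open_Int_closure_eq_empty inf_commute)
  then show ?thesis using U that by blast
qed

text \<open>The slope \<open>u = y / x\<close> of a tangency point of the line with the foliation solves
  \<open>a(u) + p b(u) = 0\<close>, where \<open>a\<close> and \<open>b\<close> are the dehomogenizations of the coefficients.\<close>

lemma homogeneous_foliation_cases:
  assumes n: "n \<ge> 2" and deg: "foliation_of_degree n H" and hom: "homogeneous H"
  obtains a b where "degree a \<le> n" "degree b \<le> n" "\<forall>u. \<not> (poly a u = 0 \<and> poly b u = 0)"
    "coeff a n \<noteq> 0 \<or> coeff b n \<noteq> 0" "a + [:0, 1:] * b \<noteq> 0"
    "\<forall>p q x. poly (tangency H (p, q)) x = binary_form n (a + smult p b) x (p * x - q)"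
proof -
  obtain A B where H: "H = (A, B)" by (cases H)
  have cop: "coprime A B" and gen: "generically (\<lambda>z. degree (tangency H z) = n)"
    using deg unfolding foliation_of_degree_def H by auto
  obtain m where m: "\<And>i j. coeff (coeff A j) i \<noteq> 0 \<Longrightarrow> i + j = m"
      "\<And>i j. coeff (coeff B j) i \<noteq> 0 \<Longrightarrow> i + j = m"
    using homogeneous_isobaric[OF cop] hom unfolding H by blast
  obtain a where a: "degree a \<le> m" "A = homogenization m a" using isobaric_homogenization[OF m(1)] .
  obtain b where b: "degree b \<le> m" "B = homogenization m b" using isobaric_homogenization[OF m(2)] .
  have H_eq: "H = (homogenization m a, homogenization m b)" by (simp add: H a b)
  have cop': "coprime (homogenization m a) (homogenization m b)" using cop a b by simp
  note noroot = coprime_homogenization_no_common_root[OF cop' a(1) b(1)]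
  note lead = coprime_homogenization_lead[OF cop']
  obtain p0 q0 where "degree (tangency H (p0, q0)) = n"
    using generically_avoid_finite[OF gen finite.emptyI] by blast
  then have nm: "n \<le> m" using degree_tangency_homogenization(1)[OF a(1) b(1)] H_eq by auto
  \<comment> \<open>The degree of the forms is so far only bounded below by \<open>n\<close>. In the
    radial case \<open>b\<close> would have no zero, hence be constant, and \<open>a\<close> would
    have degree at most 1; as \<open>m\<close> is at least 2, both coefficients of index
    \<open>m\<close> would vanish.\<close>
  have radial: "a + [:0, 1:] * b \<noteq> 0"
  proof
    assume 0: "a + [:0, 1:] * b = 0"
    then have a_eq: "a = - ([:0, 1:] * b)" by (simp add: add_eq_0_iff)
    have "poly b u \<noteq> 0" for u using noroot[of u] a_eq by auto
    then have "degree b = 0" using fundamental_theorem_of_algebra_alt[of b] by (metis degree_pCons_0)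
    moreover have "degree a \<le> degree [:0, 1::complex:] + degree b"
      unfolding a_eq degree_minus by (rule degree_mult_le)
    ultimately have "coeff a m = 0" "coeff b m = 0" using nm n by (auto intro!: coeff_eq_0)
    then show False using lead by simp
  qed
  \<comment> \<open>Away from these \<open>p\<close> the coefficient of \<open>x^m\<close> in the
    tangency polynomial is nonzero, so its degree is \<open>m\<close>; at a generic point it is also
    \<open>n\<close>.\<close>
  have "finite {p. poly (a + [:0, 1:] * b) p = 0}" using radial by (rule poly_roots_finite)
  then obtain p q where "poly (a + [:0, 1:] * b) p \<noteq> 0" "degree (tangency H (p, q)) = n"
    using generically_avoid_finite[OF gen] by blast
  then have "n = m"
    using degree_tangency_homogenization[OF a(1) b(1), of p q] H_eq by (metis le_antisym le_degree)
  then show ?thesis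
    using that[of a b] a(1) b(1) noroot lead radial tangency_homogenization[of m a b] unfolding H_eq by blast
qed

section \<open>Local decompositions of the Legendre transform\<close>

text \<open>The equation is linear in \<open>p\<close>, so it can be solved as
  \<open>p = f u\<close> with \<open>f = - a / b\<close>. A simple root is a point where the
  derivative of \<open>f\<close> does not vanish, and the branch is the local inverse of
  \<open>f\<close>.\<close>

lemma root_branch:
  fixes a b :: "complex poly"
  assumes b: "poly b u \<noteq> 0" and root: "poly (a + smult p0 b) u = 0"
    and simple: "poly (pderiv (a + smult p0 b)) u \<noteq> 0"
  obtains \<epsilon> \<upsilon> where "0 < \<epsilon>" "\<upsilon> holomorphic_on ball p0 \<epsilon>" "\<upsilon> p0 = u"
    "\<And>p. p \<in> ball p0 \<epsilon> \<Longrightarrow> poly (a + smult p b) (\<upsilon> p) = 0"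
proof -
  define S where "S = {u. poly b u \<noteq> 0}"
  define f where "f = (\<lambda>u. - poly a u / poly b u)"
  have S: "open S" "u \<in> S" using b by (auto simp: S_def intro!: open_Collect_neq continuous_intros)
  have hol: "f holomorphic_on S"
    unfolding f_def S_def by (intro holomorphic_intros) auto
  have pa: "poly a u = - p0 * poly b u" using root by (simp add: add_eq_0_iff)
  have "(f has_field_derivative
      (- poly (pderiv a) u * poly b u - (- poly a u) * poly (pderiv b) u) / (poly b u * poly b u)) (at u)"
    unfolding f_def using b by (intro DERIV_divide DERIV_minus poly_DERIV)
  also have "(- poly (pderiv a) u * poly b u - (- poly a u) * poly (pderiv b) u) / (poly b u * poly b u) =
      - poly (pderiv (a + smult p0 b)) u / poly b u"
    unfolding pa using b by (simp add: pderiv_add pderiv_smult field_simps)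
  finally have "(f has_field_derivative - poly (pderiv (a + smult p0 b)) u / poly b u) (at u)" .
  then have "deriv f u = - poly (pderiv (a + smult p0 b)) u / poly b u" by (rule DERIV_imp_deriv)
  then have "deriv f u \<noteq> 0" using simple b by simp
  then obtain r where r: "0 < r" "ball u r \<subseteq> S" "open (f ` ball u r)" "inj_on f (ball u r)"
    by (rule has_complex_derivative_locally_invertible[OF hol S(2) S(1)])
  have "\<exists>g. g holomorphic_on (f ` ball u r) \<and> (\<forall>z\<in>ball u r. g (f z) = z)"
    by (rule holomorphic_has_inverse[OF holomorphic_on_subset[OF hol r(2)] open_ball r(4)]) blast
  then obtain g where g: "g holomorphic_on (f ` ball u r)" "\<And>z. z \<in> ball u r \<Longrightarrow> g (f z) = z"
    by blast
  have fu: "f u = p0" using b pa by (simp add: f_def)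
  then have "p0 \<in> f ` ball u r" using r(1) by (intro image_eqI[of _ _ u]) auto
  then obtain \<epsilon> where e: "0 < \<epsilon>" "ball p0 \<epsilon> \<subseteq> f ` ball u r"
    using r(3) open_contains_ball by blast
  show ?thesis
  proof (rule that[OF e(1)])
    show "g holomorphic_on ball p0 \<epsilon>" using g(1) e(2) by (rule holomorphic_on_subset)
    show "g p0 = u" using g(2)[of u] r(1) fu by simp
    fix p assume "p \<in> ball p0 \<epsilon>"
    then obtain v where v: "v \<in> ball u r" "p = f v" using e(2) by blast
    then have "poly b v \<noteq> 0" using r(2) by (auto simp: S_def)
    then show "poly (a + smult p b) (g p) = 0"
      using g(2)[OF v(1)] v(2) by (simp add: f_def)
  qed
qed

lemma card_simple_roots:
  fixes c :: "complex poly"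
  assumes "\<And>u. \<not> (poly c u = 0 \<and> poly (pderiv c) u = 0)"
  shows "card {u. poly c u = 0} = degree c"
proof -
  have rs: "rsquarefree c" using assms by (simp add: rsquarefree_roots)
  then have c0: "c \<noteq> 0" by (simp add: rsquarefree_def)
  have "degree c = degree (smult (lead_coeff c) (\<Prod>z|poly c z = 0. [:-z, 1:]))"
    by (rule arg_cong[OF complex_poly_decompose_rsquarefree[OF rs], of degree, symmetric])
  also have "\<dots> = card {u. poly c u = 0}"
    using c0 by (simp add: degree_prod_sum_eq)
  finally show ?thesis ..
qed

lemma holomorphic2_product:
  assumes "open N" "s holomorphic_on N"
  shows "holomorphic2_on (\<lambda>z. snd z * s (fst z)) (N \<times> T)"
  unfolding holomorphic2_on_def
proof
  fix z :: point assume "z \<in> N \<times> T"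
  then have "(s has_field_derivative deriv s (fst z)) (at (fst z))"
    using assms by (intro holomorphic_derivI) auto
  then have 1: "(s has_derivative (\<lambda>v. deriv s (fst z) * v)) (at (fst z))"
    by (simp add: has_field_derivative_def)
  have "(fst has_derivative fst) (at z)" by (rule has_derivative_fst[OF has_derivative_ident])
  from has_derivative_compose[OF this 1]
  have 2: "((\<lambda>z. s (fst z)) has_derivative (\<lambda>v. deriv s (fst z) * fst v)) (at z)" by simp
  have "((\<lambda>z. snd z * s (fst z)) has_derivative
      (\<lambda>v. snd z * (deriv s (fst z) * fst v) + snd v * s (fst z))) (at z)"
    by (rule has_derivative_mult[OF has_derivative_snd[OF has_derivative_ident] 2])
  also have "(\<lambda>v. snd z * (deriv s (fst z) * fst v) + snd v * s (fst z)) =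
      (\<lambda>v. (snd z * deriv s (fst z)) * fst v + s (fst z) * snd v)"
    by (simp add: fun_eq_iff)
  finally show "\<exists>a b. ((\<lambda>z. snd z * s (fst z)) has_derivative (\<lambda>v. a * fst v + b * snd v)) (at z)"
    by blast
qed

lemma holomorphic2_const: "holomorphic2_on (\<lambda>_. c) U"
  unfolding holomorphic2_on_def
  by (intro ballI exI[of _ 0]) (simp add: has_derivative_const)

section \<open>Tangent directions as slopes\<close>

lemma form_kernel_eq_slope:
  assumes "form_kernel w z = {v. snd v = x * fst v}"
  shows "snd (w z) \<noteq> 0" "fst (w z) = - x * snd (w z)"
proof -
  have "(0, 1) \<notin> form_kernel w z" unfolding assms by simp
  then show "snd (w z) \<noteq> 0" by (simp add: form_kernel_def)
  have "(1, x) \<in> form_kernel w z" unfolding assms by simp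
  then have "fst (w z) + snd (w z) * x = 0" by (simp add: form_kernel_def)
  then show "fst (w z) = - x * snd (w z)" by algebra
qed

lemma form_kernel_slope:
  assumes "snd (w z) \<noteq> 0"
  shows "form_kernel w z = {v. snd v = (- fst (w z) / snd (w z)) * fst v}"
proof -
  have "fst (w z) * x + snd (w z) * y = 0 \<longleftrightarrow> y = (- fst (w z) / snd (w z)) * x" for x y
  proof -
    have "(- fst (w z) / snd (w z)) * x = - (fst (w z) * x) / snd (w z)" by simp
    then show ?thesis using nonzero_eq_divide_eq[OF assms, of y "- (fst (w z) * x)"]
      by (simp add: add_eq_0_iff mult.commute)
  qed
  then show ?thesis by (simp add: form_kernel_def)
qed

lemma inj_slope: "inj (\<lambda>x :: complex. {v. snd v = x * fst v})"
proof (rule injI)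
  fix x y :: complex assume "{v. snd v = x * fst v} = {v. snd v = y * fst v}"
  moreover have "(1, x) \<in> {v. snd v = x * fst v}" by simp
  ultimately have "(1, x) \<in> {v. snd v = y * fst v}" by blast
  then show "x = y" by simp
qed

lemma leg_prefoliation_infinity:
  "leg_prefoliation (line_infinity, H) z = insert {v. fst v = 0} (leg_foliation H z)"
  by (cases z) (simp add: leg_prefoliation_def superpose_def leg_line_def line_infinity_def form_kernel_def)

lemma leg_foliation_slopes:
  "leg_foliation H z = (\<lambda>x. {v. snd v = x * fst v}) ` {x. poly (tangency H z) x = 0}"
  by (auto simp: leg_foliation_def)

lemma web_forms_leg_slope:
  assumes "web_forms k W U w" "z \<in> U" "i < k" "W z = leg_foliation H z"
  shows "snd (w i z) \<noteq> 0"
proof -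
  have "W z = (\<lambda>i. form_kernel (w i) z) ` {..<k}"
    using assms(1,2) by (simp add: web_forms_def)
  then have "form_kernel (w i) z \<in> leg_foliation H z"
    using assms(3) unfolding assms(4)[symmetric] by simp
  then obtain x where "form_kernel (w i) z = {v. snd v = x * fst v}"
    unfolding leg_foliation_slopes by (elim imageE)
  then show ?thesis by (rule form_kernel_eq_slope(1))
qed

text \<open>\<open>leg_foliation\<close> consists of directions with finite slope only, so
  \<open>dp\<close>, whose kernel is vertical, is transverse to it at every regular point.\<close>

lemma web_forms_add_infinity:
  assumes w: "web_forms n (leg_foliation H) U w"
  shows "web_forms (Suc n) (leg_prefoliation (line_infinity, H)) U
    (\<lambda>i. if i < n then w i else (\<lambda>_. (1, 0)))"
proof -
  have snd: "snd (w i z) \<noteq> 0" if "z \<in> U" "i < n" for i z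
    using web_forms_leg_slope[OF w that] by simp
  have ker: "form_kernel (\<lambda>_. (1, 0)) z = {v. fst v = 0}" for z
    by (simp add: form_kernel_def)
  have im: "(\<lambda>i. form_kernel (if i < n then w i else (\<lambda>_. (1, 0))) z) ` {..<Suc n} =
      insert {v. fst v = 0} ((\<lambda>i. form_kernel (w i) z) ` {..<n})" for z
    by (simp add: lessThan_Suc ker)
  show ?thesis
    using w unfolding web_forms_def leg_prefoliation_infinity im
    by (auto simp: holomorphic2_const wedge_def snd less_Suc_eq zero_prod_def)
qed

text \<open>On the ray of slope \<open>u\<close> the line \<open>y = p x - q\<close> has the
  abscissa \<open>x = q / (p - u)\<close>, so the slopes of the web are \<open>q / (p - u)\<close>
  for the roots \<open>u\<close> of \<open>a + p b\<close>. The hypotheses keep these finite and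
  distinct: \<open>lead\<close> excludes a tangency point with \<open>x = 0\<close>,
  \<open>diag\<close> one at infinity, where \<open>u = p\<close>, and \<open>simple\<close> makes
  the \<open>n\<close> roots distinct. All of this persists near \<open>p0\<close>.\<close>

lemma leg_foliation_regular:
  assumes deg: "degree a \<le> n" "degree b \<le> n" and cop: "\<And>u. \<not> (poly a u = 0 \<and> poly b u = 0)"
    and tang: "\<And>p q x. poly (tangency H (p, q)) x = binary_form n (a + smult p b) x (p * x - q)"
    and q0: "q0 \<noteq> 0" and lead: "coeff (a + smult p0 b) n \<noteq> 0"
    and diag: "poly (a + smult p0 b) p0 \<noteq> 0"
    and simple: "\<And>u. \<not> (poly (a + smult p0 b) u = 0 \<and> poly (pderiv (a + smult p0 b)) u = 0)"
  shows "\<exists>U w. (p0, q0) \<in> U \<and> web_forms n (leg_foliation H) U w"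
proof -
  define c where "c p = a + smult p b" for p
  have degc: "degree (c p) \<le> n" for p
    unfolding c_def using deg by (intro degree_add_le) (auto intro: le_trans[OF degree_smult_le])
  have "degree (c p0) = n" using lead degc[of p0] le_degree[of "c p0" n] by (simp add: c_def)
  then have card: "card {u. poly (c p0) u = 0} = n"
    using card_simple_roots[OF simple] by (simp only: c_def)
  have "c p0 \<noteq> 0" using lead unfolding c_def by (metis coeff_0)
  then have "finite {u. poly (c p0) u = 0}" by (rule poly_roots_finite)
  then obtain e where e: "bij_betw e {..<n} {u. poly (c p0) u = 0}"
    using ex_bij_betw_nat_finite card by (metis atLeast0LessThan)
  have e_root: "poly (c p0) (e i) = 0" if "i < n" for i using bij_betwE[OF e] that by auto
  have "\<exists>\<epsilon> \<upsilon>. 0 < \<epsilon> \<and> \<upsilon> holomorphic_on ball p0 \<epsilon> \<and> \<upsilon> p0 = e i \<and>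
      (\<forall>p\<in>ball p0 \<epsilon>. poly (c p) (\<upsilon> p) = 0)" if i: "i < n" for i
  proof -
    have "poly b (e i) \<noteq> 0" using cop[of "e i"] e_root[OF i] by (auto simp: c_def)
    moreover have "poly (pderiv (a + smult p0 b)) (e i) \<noteq> 0" using simple[of "e i"] e_root[OF i] by (simp add: c_def)
    ultimately obtain \<epsilon> \<upsilon> where "0 < \<epsilon>" "\<upsilon> holomorphic_on ball p0 \<epsilon>" "\<upsilon> p0 = e i"
      "\<And>p. p \<in> ball p0 \<epsilon> \<Longrightarrow> poly (a + smult p b) (\<upsilon> p) = 0"
      using root_branch[of b "e i" a p0] e_root[OF i] unfolding c_def by blast
    then show ?thesis unfolding c_def by blast
  qed
  then obtain \<epsilon> \<upsilon> where br: "\<And>i. i < n \<Longrightarrow> 0 < \<epsilon> i" "\<And>i. i < n \<Longrightarrow> \<upsilon> i holomorphic_on ball p0 (\<epsilon> i)"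
      "\<And>i. i < n \<Longrightarrow> \<upsilon> i p0 = e i" "\<And>i p. i < n \<Longrightarrow> p \<in> ball p0 (\<epsilon> i) \<Longrightarrow> poly (c p) (\<upsilon> i p) = 0"
    by metis
  have cont: "isCont (\<upsilon> i) p0" if "i < n" for i
    using holomorphic_on_imp_continuous_on[OF br(2)[OF that]] br(1)[OF that]
    by (simp add: continuous_on_eq_continuous_at)
  have ev_ne: "eventually (\<lambda>p. f p \<noteq> g p) (nhds p0)"
    if "isCont f p0" "isCont g p0" "f p0 \<noteq> g p0" for f g :: "complex \<Rightarrow> complex"
  proof -
    have "((\<lambda>p. f p - g p) \<longlongrightarrow> f p0 - g p0) (nhds p0)"
      using tendsto_at_iff_tendsto_nhds[of "\<lambda>p. f p - g p" p0] that
      by (auto simp: isCont_def intro: tendsto_diff)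
    then have "eventually (\<lambda>p. f p - g p \<noteq> 0) (nhds p0)"
      by (rule tendsto_imp_eventually_ne) (use that in simp)
    then show ?thesis by eventually_elim simp
  qed
  have "eventually (\<lambda>p. \<forall>i\<in>{..<n}. p \<in> ball p0 (\<epsilon> i)) (nhds p0)"
    using br(1) by (intro eventually_ball_finite ballI eventually_nhds_in_open) auto
  moreover have "eventually (\<lambda>p. \<forall>i\<in>{..<n}. \<upsilon> i p \<noteq> p) (nhds p0)"
    using e_root diag br(3) by (intro eventually_ball_finite ballI ev_ne cont continuous_ident)
      (auto simp: c_def)
  moreover have "eventually (\<lambda>p. \<forall>i\<in>{..<n}. \<forall>j\<in>{..<n} - {i}. \<upsilon> i p \<noteq> \<upsilon> j p) (nhds p0)"
    using br(3) bij_betw_imp_inj_on[OF e]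
    by (intro eventually_ball_finite ballI ev_ne cont) (auto simp: inj_on_def)
  moreover have "eventually (\<lambda>p. coeff (c p) n \<noteq> 0) (nhds p0)"
    using lead unfolding c_def by (intro ev_ne) (auto intro!: continuous_intros)
  ultimately have "eventually (\<lambda>p. (\<forall>i\<in>{..<n}. p \<in> ball p0 (\<epsilon> i)) \<and> (\<forall>i\<in>{..<n}. \<upsilon> i p \<noteq> p) \<and>
      (\<forall>i\<in>{..<n}. \<forall>j\<in>{..<n} - {i}. \<upsilon> i p \<noteq> \<upsilon> j p) \<and> coeff (c p) n \<noteq> 0) (nhds p0)"
    by eventually_elim simp
  then obtain N where N: "open N" "p0 \<in> N" and
    NP: "\<And>p i. p \<in> N \<Longrightarrow> i < n \<Longrightarrow> p \<in> ball p0 (\<epsilon> i)" "\<And>p i. p \<in> N \<Longrightarrow> i < n \<Longrightarrow> \<upsilon> i p \<noteq> p"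
      "\<And>p i j. p \<in> N \<Longrightarrow> i < n \<Longrightarrow> j < n \<Longrightarrow> i \<noteq> j \<Longrightarrow> \<upsilon> i p \<noteq> \<upsilon> j p"
      "\<And>p. p \<in> N \<Longrightarrow> coeff (c p) n \<noteq> 0"
    unfolding eventually_nhds by auto
  define s where "s i p = 1 / (p - \<upsilon> i p)" for i p
  define w :: "nat \<Rightarrow> one_form" where "w i = (\<lambda>z. (snd z * s i (fst z), -1))" for i
  have s_hol: "s i holomorphic_on N" if "i < n" for i
  proof -
    have "\<upsilon> i holomorphic_on N" using br(2)[OF that] by (rule holomorphic_on_subset) (use NP(1) that in blast)
    moreover have "p - \<upsilon> i p \<noteq> 0" if "p \<in> N" for p using NP(2)[OF that \<open>i < n\<close>] by simp
    ultimately show ?thesis unfolding s_def[abs_def] by (intro holomorphic_intros)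
  qed
  have s_neq: "s i p \<noteq> s j p" if "p \<in> N" "i < n" "j < n" "i \<noteq> j" for i j p
    using NP(2)[of p i] NP(2)[of p j] NP(3)[of p i j] that by (auto simp: s_def)
  \<comment> \<open>The \<open>n\<close> branches give \<open>n\<close> distinct roots of a
    polynomial of degree at most \<open>n\<close>, hence all of them.\<close>
  have roots: "{u. poly (c p) u = 0} = (\<lambda>i. \<upsilon> i p) ` {..<n}" if p: "p \<in> N" for p
  proof (rule card_seteq[symmetric])
    have "c p \<noteq> 0" using NP(4)[OF p] by auto
    then show "finite {u. poly (c p) u = 0}" by (rule poly_roots_finite)
    have "card {u. poly (c p) u = 0} \<le> degree (c p)" using \<open>c p \<noteq> 0\<close> by (rule card_poly_roots_bound)
    also have "\<dots> \<le> n" by (rule degc)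
    also have "n = card ((\<lambda>i. \<upsilon> i p) ` {..<n})"
      using NP(3)[OF p] by (subst card_image) (auto simp: inj_on_def)
    finally show "card {u. poly (c p) u = 0} \<le> card ((\<lambda>i. \<upsilon> i p) ` {..<n})" .
    show "(\<lambda>i. \<upsilon> i p) ` {..<n} \<subseteq> {u. poly (c p) u = 0}"
      using br(4) NP(1)[OF p] by auto
  qed
  have tangency_roots: "{x. poly (tangency H (p, q)) x = 0} = (\<lambda>i. q * s i p) ` {..<n}"
    if p: "p \<in> N" and q: "q \<noteq> 0" for p q
  proof (intro equalityI subsetI)
    fix x assume "x \<in> {x. poly (tangency H (p, q)) x = 0}"
    then have x: "binary_form n (c p) x (p * x - q) = 0" by (simp add: tang c_def)
    have x0: "x \<noteq> 0" using x NP(4)[OF p] q by (auto simp: binary_form_0)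
    define u where "u = (p * x - q) / x"
    have xu: "p * x - q = x * u" using x0 by (simp add: u_def)
    have "poly (c p) u = 0" using x x0 unfolding xu by (simp add: binary_form_slope degc)
    then obtain i where i: "i < n" "u = \<upsilon> i p" using roots[OF p] by auto
    have "q = x * (p - \<upsilon> i p)" using xu i(2) by (simp add: algebra_simps)
    then have "x = q * s i p" using NP(2)[OF p i(1)] by (simp add: s_def)
    then show "x \<in> (\<lambda>i. q * s i p) ` {..<n}" using i(1) by blast
  next
    fix x assume "x \<in> (\<lambda>i. q * s i p) ` {..<n}"
    then obtain i where i: "i < n" "x = q * s i p" by blast
    have "p * x - q = x * \<upsilon> i p"
      using NP(2)[OF p i(1)] by (simp add: i(2) s_def field_simps)
    moreover have "poly (c p) (\<upsilon> i p) = 0" using br(4) NP(1)[OF p] i(1) by blast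
    ultimately have "binary_form n (c p) x (p * x - q) = 0" by (simp add: binary_form_slope degc)
    then show "x \<in> {x. poly (tangency H (p, q)) x = 0}" by (simp add: tang c_def)
  qed
  define U where "U = N \<times> (- {0 :: complex})"
  have "web_forms n (leg_foliation H) U w"
    unfolding web_forms_def
  proof (intro conjI allI impI ballI)
    show "open U" unfolding U_def using N(1) by (intro open_Times) auto
  next
    fix i assume i: "i < n"
    show "holomorphic2_on (\<lambda>z. fst (w i z)) U" unfolding w_def U_def
      using holomorphic2_product[OF N(1) s_hol[OF i]] by simp
    show "holomorphic2_on (\<lambda>z. snd (w i z)) U" unfolding w_def by (simp add: holomorphic2_const)
    fix z assume "z \<in> U"
    show "w i z \<noteq> 0" by (simp add: w_def prod_eq_iff)
  next
    fix i j z assume "i < n" "j < n" "i \<noteq> j" "z \<in> U"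
    then show "wedge (w i) (w j) z \<noteq> 0"
      using s_neq[of "fst z" i j] by (auto simp: wedge_def w_def U_def)
  next
    fix z assume "z \<in> U"
    then have z: "fst z \<in> N" "snd z \<noteq> 0" by (auto simp: U_def)
    have "form_kernel (w i) z = {v. snd v = snd z * s i (fst z) * fst v}" for i
      using form_kernel_slope[of "w i" z] by (simp add: w_def)
    then show "leg_foliation H z = (\<lambda>i. form_kernel (w i) z) ` {..<n}"
      unfolding leg_foliation_slopes using tangency_roots[OF z] by (simp add: image_image)
  qed
  moreover have "(p0, q0) \<in> U" using N(2) q0 by (simp add: U_def)
  ultimately show ?thesis by blast
qed

text \<open>A multiple root of \<open>a + p b\<close> is a zero of the Wronskian of \<open>a\<close>
  and \<open>b\<close>, and it determines \<open>p = - a / b\<close>. If the Wronskian vanished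
  identically, coprimality would make \<open>a\<close> and \<open>b\<close> divide their own
  derivatives; both would be constant, against the coefficient of index
  \<open>n > 0\<close>.\<close>

lemma finite_multiple_root_parameters:
  fixes a b :: "complex poly"
  assumes cop: "\<And>u. \<not> (poly a u = 0 \<and> poly b u = 0)" and n: "0 < n" "coeff a n \<noteq> 0 \<or> coeff b n \<noteq> 0"
  shows "finite {p. \<exists>u. poly (a + smult p b) u = 0 \<and> poly (pderiv (a + smult p b)) u = 0}"
proof -
  let ?W = "a * pderiv b - pderiv a * b"
  have "?W \<noteq> 0"
  proof
    assume W: "?W = 0"
    have "coprime a b"
    proof (rule ccontr)
      assume "\<not> coprime a b"
      then have nu: "\<not> is_unit (gcd a b)" unfolding is_unit_gcd .
      have "\<exists>z. poly (gcd a b) z = 0"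
      proof (rule fundamental_theorem_of_algebra_alt, rule notI)
        assume "\<exists>k l. k \<noteq> 0 \<and> l = 0 \<and> gcd a b = pCons k l"
        then obtain k where "k \<noteq> 0" "gcd a b = [:k:]" by blast
        then have "is_unit (gcd a b)" by (simp only: is_unit_pCons_iff) simp
        with nu show False by (rule notE)
      qed
      then obtain z where "poly (gcd a b) z = 0" ..
      moreover obtain a' b' where "a = gcd a b * a'" "b = gcd a b * b'"
        using gcd_dvd1[of a b] gcd_dvd2[of a b] unfolding dvd_def by blast
      ultimately have "poly a z = 0" "poly b z = 0" by (metis poly_mult mult_zero_left)+
      then show False using cop by blast
    qed
    have "b dvd a * pderiv b" using W by simp
    then have b: "b dvd pderiv b" using \<open>coprime a b\<close> by (simp add: coprime_dvd_mult_right_iff coprime_commute)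
    have "a dvd pderiv a * b" using W by (metis dvd_triv_left eq_iff_diff_eq_0)
    then have a: "a dvd pderiv a" using \<open>coprime a b\<close> by (simp add: coprime_dvd_mult_left_iff)
    have "degree a = 0" "degree b = 0" using a b by (simp_all add: dvd_pderiv_iff)
    then show False using n by (auto simp: coeff_eq_0)
  qed
  then have "finite {u. poly ?W u = 0}" by (rule poly_roots_finite)
  then have "finite ((\<lambda>u. - poly a u / poly b u) ` {u. poly ?W u = 0})" by (rule finite_imageI)
  moreover have "{p. \<exists>u. poly (a + smult p b) u = 0 \<and> poly (pderiv (a + smult p b)) u = 0} \<subseteq>
      (\<lambda>u. - poly a u / poly b u) ` {u. poly ?W u = 0}"
  proof
    fix p assume "p \<in> {p. \<exists>u. poly (a + smult p b) u = 0 \<and> poly (pderiv (a + smult p b)) u = 0}"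
    then obtain u where u: "poly a u = - p * poly b u" "poly (pderiv a) u = - p * poly (pderiv b) u"
      by (auto simp: pderiv_add pderiv_smult eq_neg_iff_add_eq_0)
    have "poly b u \<noteq> 0" using cop[of u] u(1) by auto
    then have "p = - poly a u / poly b u" using u(1) by simp
    moreover have "poly ?W u = 0" by (simp add: u)
    ultimately show "p \<in> (\<lambda>u. - poly a u / poly b u) ` {u. poly ?W u = 0}" by blast
  qed
  ultimately show ?thesis by (rule finite_subset[rotated])
qed

lemma generically_offI:
  assumes "finite S" "\<And>p q. p \<notin> S \<Longrightarrow> q \<noteq> 0 \<Longrightarrow> P (p, q)"
  shows "generically P"
  unfolding generically_def
proof (intro exI conjI)
  show "open ((- S) \<times> (- {0 :: complex}))" using assms(1) by (intro open_Times) (auto intro: finite_imp_closed)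
  have "interior S = {}" using assms(1) 
    using finite_imp_not_open[OF finite_subset[OF interior_subset] open_interior] by blast
  moreover have "interior {0 :: complex} = {}" by simp
  ultimately show "closure ((- S) \<times> (- {0 :: complex})) = UNIV"
    by (simp add: closure_Times closure_complement)
qed (use assms(2) in auto)

lemma leg_foliation_is_web:
  assumes deg: "degree a \<le> n" "degree b \<le> n" and cop: "\<And>u. \<not> (poly a u = 0 \<and> poly b u = 0)"
    and n: "0 < n" "coeff a n \<noteq> 0 \<or> coeff b n \<noteq> 0" and radial: "a + [:0, 1:] * b \<noteq> 0"
    and tang: "\<And>p q x. poly (tangency H (p, q)) x = binary_form n (a + smult p b) x (p * x - q)"
  shows "is_web n (leg_foliation H)"
proof -
  \<comment> \<open>The three sets are where the conditions \<open>lead\<close>, \<open>diag\<close>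
    and \<open>simple\<close> of the regularity lemma fail.\<close>
  define S where "S = {p. coeff a n + p * coeff b n = 0} \<union> {p. poly (a + [:0, 1:] * b) p = 0} \<union>
    {p. \<exists>u. poly (a + smult p b) u = 0 \<and> poly (pderiv (a + smult p b)) u = 0}"
  have "[:coeff a n, coeff b n:] \<noteq> 0" using n by auto
  from poly_roots_finite[OF this] have "finite S"
    unfolding S_def using poly_roots_finite[OF radial] finite_multiple_root_parameters[OF cop n] by simp
  then show ?thesis
    unfolding is_web_def
  proof (rule generically_offI)
    fix p q :: complex assume "p \<notin> S" "q \<noteq> 0"
    then show "web_regular_at n (leg_foliation H) (p, q)"
      unfolding web_regular_at_def
      by (intro leg_foliation_regular[OF deg cop tang]) (auto simp: S_def)
  qed
qed

text \<open>Read in a box around \<open>(p0, q0)\<close>, the forms of a local decomposition of the Legendre transform are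
  \<open>invariant_forms\<close>: by homogeneity the quotient of a slope by \<open>q\<close> takes values in a finite set
  depending on \<open>p\<close> only, so that it does not depend on \<open>q\<close>.\<close>

lemma leg_invariant_forms:
  fixes w :: "nat \<Rightarrow> one_form" and p0 q0 :: complex and \<epsilon> :: real
  defines "\<sigma> \<equiv> \<lambda>i p. - fst (w i (p, q0)) / snd (w i (p, q0)) / q0"
  defines "g \<equiv> \<lambda>i z. - snd (w i z) * snd z"
  assumes deg: "degree a \<le> n" "degree b \<le> n"
    and tang: "\<And>p q x. poly (tangency H (p, q)) x = binary_form n (a + smult p b) x (p * x - q)"
    and J: "finite J" "card J \<ge> 2"
    and \<epsilon>: "0 < \<epsilon>" "ball p0 \<epsilon> \<times> ball q0 \<epsilon> \<subseteq> U"
    and hol: "\<And>i. i \<in> J \<Longrightarrow> holomorphic2_on (\<lambda>z. fst (w i z)) U"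
      "\<And>i. i \<in> J \<Longrightarrow> holomorphic2_on (\<lambda>z. snd (w i z)) U"
    and tr: "\<And>i j z. i \<in> J \<Longrightarrow> j \<in> J \<Longrightarrow> i \<noteq> j \<Longrightarrow> z \<in> U \<Longrightarrow> wedge (w i) (w j) z \<noteq> 0"
    and leg: "\<And>z. z \<in> U \<Longrightarrow> leg_foliation H z = (\<lambda>i. form_kernel (w i) z) ` J"
  shows "invariant_forms (ball p0 \<epsilon>) (ball q0 \<epsilon>) J w g \<sigma> (\<lambda>_. 1)"
    and "p \<in> ball p0 \<epsilon> \<Longrightarrow>
      (\<lambda>i. \<sigma> i p) ` J = {s. binary_form n (a + smult p b) s (p * s - 1) = 0}"
proof -
  define c where "c p = a + smult p b" for p
  have degc: "degree (c p) \<le> n" for p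
    unfolding c_def using deg by (intro degree_add_le) (auto intro: le_trans[OF degree_smult_le])
  define x where "x i z = - fst (w i z) / snd (w i z)" for i z
  have snd_nz: "snd (w i z) \<noteq> 0" if i: "i \<in> J" and z: "z \<in> U" for i z
  proof -
    have "form_kernel (w i) z \<in> leg_foliation H z" using i unfolding leg[OF z] by (rule imageI)
    then obtain x where "form_kernel (w i) z = {v. snd v = x * fst v}"
      unfolding leg_foliation_slopes by (elim imageE)
    then show ?thesis by (rule form_kernel_eq_slope(1))
  qed
  have x_neq: "x i z \<noteq> x j z" if "i \<in> J" "j \<in> J" "i \<noteq> j" "z \<in> U" for i j z
    using tr[OF that] snd_nz[OF that(1,4)] snd_nz[OF that(2,4)]
    by (simp add: x_def wedge_def frac_eq_eq) (simp add: mult.commute)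
  have roots: "{s. binary_form n (c (fst z)) s (fst z * s - snd z) = 0} = (\<lambda>i. x i z) ` J"
    if z: "z \<in> U" for z
  proof -
    have "(\<lambda>x. {v. snd v = x * fst v}) ` {s. poly (tangency H z) s = 0} =
      (\<lambda>x. {v. snd v = x * fst v}) ` ((\<lambda>i. x i z) ` J)"
      unfolding leg_foliation_slopes[symmetric] leg[OF z] image_image
    proof (rule image_cong[OF refl])
      fix i assume "i \<in> J"
      then show "form_kernel (w i) z = {v. snd v = x i z * fst v}"
        unfolding x_def using snd_nz z by (intro form_kernel_slope)
    qed
    then have "{s. poly (tangency H z) s = 0} = (\<lambda>i. x i z) ` J"
      by (simp only: inj_image_eq_iff[OF inj_slope])
    then show ?thesis using tang[of "fst z" "snd z"] by (simp add: c_def)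
  qed
  \<comment> \<open>For \<open>q = 0\<close> the equation for the slopes reads
    \<open>s^n c(p) = 0\<close>, with \<open>c(p)\<close> the value at \<open>p\<close> of the
    polynomial \<open>a + p b\<close>. Its solutions are all complex numbers or at most 0, but there
    are finitely many and at least two.\<close>
  have q_nz: "snd z \<noteq> 0" if z: "z \<in> U" for z
  proof
    assume 0: "snd z = 0"
    let ?R = "(\<lambda>i. x i z) ` J"
    have R: "?R = {s. s ^ n * poly (c (fst z)) (fst z) = 0}"
      using roots[OF z] 0 by (simp add: mult.commute[of "fst z"] binary_form_slope degc)
    have "card ?R = card J"
      using x_neq[OF _ _ _ z] by (intro card_image) (auto simp: inj_on_def)
    then have card: "card ?R \<ge> 2" using J by simp
    show False
    proof (cases "poly (c (fst z)) (fst z) = 0")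
      case True
      then have "?R = UNIV" unfolding R by simp
      then show False using J(1) infinite_UNIV_char_0[where 'a = complex] by (metis finite_imageI)
    next
      case False
      then have "?R \<subseteq> {0}" unfolding R by auto
      then have "card ?R \<le> card {0 :: complex}" by (intro card_mono) auto
      then show False using card by simp
    qed
  qed
  have scale: "binary_form n (c p) s (p * s - 1) = 0 \<longleftrightarrow> binary_form n (c p) (q * s) (p * (q * s) - q) = 0"
    if "q \<noteq> 0" for p q s
    using binary_form_scale[of n "c p" q s "p * s - 1"] that by (simp add: algebra_simps)
  have box: "(p, q) \<in> U" if "p \<in> ball p0 \<epsilon>" "q \<in> ball q0 \<epsilon>" for p q using \<epsilon>(2) that by auto
  have q0: "q0 \<in> ball q0 \<epsilon>" "q0 \<noteq> 0" using \<epsilon>(1) q_nz[OF box[of p0 q0]] by auto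
  have \<sigma>: "\<sigma> i p = x i (p, q0) / q0" for i p by (simp add: \<sigma>_def x_def)
  have root_set: "(\<lambda>i. x i (p, q) / q) ` J = {s. binary_form n (c p) s (p * s - 1) = 0}"
    if p: "p \<in> ball p0 \<epsilon>" and q: "q \<in> ball q0 \<epsilon>" for p q
  proof -
    have qnz: "q \<noteq> 0" using q_nz[OF box[OF p q]] by simp
    have eq: "{s. binary_form n (c p) s (p * s - q) = 0} = (\<lambda>i. x i (p, q)) ` J"
      using roots[OF box[OF p q]] by simp
    have "s \<in> (\<lambda>i. x i (p, q) / q) ` J \<longleftrightarrow> q * s \<in> (\<lambda>i. x i (p, q)) ` J" for s
      using qnz by (auto simp: image_iff field_simps)
    then show ?thesis unfolding eq[symmetric] using scale[OF qnz] by auto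
  qed
  have sep: "separately_holomorphic_on (\<lambda>z. fst (w i z)) U" "separately_holomorphic_on (\<lambda>z. snd (w i z)) U"
    if "i \<in> J" for i
    using hol that holomorphic2_imp_separately by blast+
  \<comment> \<open>A continuous function with finite range on the connected ball is constant; it is
    compared with its value at the reference point \<open>q0\<close> used to define
    \<open>\<sigma>\<close>.\<close>
  have x_eq: "x i (p, q) = q * \<sigma> i p" if i: "i \<in> J" and p: "p \<in> ball p0 \<epsilon>" and q: "q \<in> ball q0 \<epsilon>" for i p q
  proof -
    have qnz: "q \<noteq> 0" if "q \<in> ball q0 \<epsilon>" for q using q_nz[OF box[OF p that]] by simp
    have slice: "continuous_on (ball q0 \<epsilon>) (\<lambda>q. f (p, q))" if "continuous_on U f" for f :: "point \<Rightarrow> complex"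
      by (rule continuous_on_compose2[OF that]) (use box p in \<open>auto intro!: continuous_intros\<close>)
    have "continuous_on (ball q0 \<epsilon>) (\<lambda>q. fst (w i (p, q)))" "continuous_on (ball q0 \<epsilon>) (\<lambda>q. snd (w i (p, q)))"
      using sep[OF i] slice unfolding separately_holomorphic_on_def by auto
    then have "continuous_on (ball q0 \<epsilon>) (\<lambda>q. x i (p, q) / q)"
      unfolding x_def using snd_nz[OF i box[OF p]] qnz
      by (intro continuous_on_divide continuous_on_minus continuous_on_id) auto
    moreover have "finite ((\<lambda>q. x i (p, q) / q) ` ball q0 \<epsilon>)"
    proof (rule finite_subset)
      show "(\<lambda>q. x i (p, q) / q) ` ball q0 \<epsilon> \<subseteq> {s. binary_form n (c p) s (p * s - 1) = 0}"
        using root_set[OF p] i by blast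
      show "finite {s. binary_form n (c p) s (p * s - 1) = 0}"
        using J(1) unfolding root_set[OF p q, symmetric] by (rule finite_imageI)
    qed
    ultimately have "(\<lambda>q. x i (p, q) / q) constant_on ball q0 \<epsilon>"
      by (intro continuous_finite_range_constant) auto
    then have "x i (p, q) / q = x i (p, q0) / q0"
      using q q0(1) unfolding constant_on_def by metis
    then show ?thesis using qnz[OF q] by (simp add: \<sigma> field_simps)
  qed
  show "invariant_forms (ball p0 \<epsilon>) (ball q0 \<epsilon>) J w g \<sigma> (\<lambda>_. 1)"
  proof
    show "0 \<notin> ball q0 \<epsilon>" using q_nz[OF box[of p0 0]] \<epsilon>(1) by auto
  next
    fix i assume i: "i \<in> J"
    show "\<sigma> i holomorphic_on ball p0 \<epsilon>"
      unfolding holomorphic_on_def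
    proof
      fix p assume p: "p \<in> ball p0 \<epsilon>"
      have "(\<lambda>s. fst (w i (s, q0))) field_differentiable at p" "(\<lambda>s. snd (w i (s, q0))) field_differentiable at p"
        using sep[OF i] box[OF p q0(1)] unfolding separately_holomorphic_on_def by force+
      then have "\<sigma> i field_differentiable at p"
        unfolding \<sigma>_def using snd_nz[OF i box[OF p q0(1)]] q0(2)
        by (intro field_differentiable_divide field_differentiable_minus field_differentiable_const) auto
      then show "\<sigma> i field_differentiable at p within ball p0 \<epsilon>"
        by (rule field_differentiable_at_within)
    qed
    show "separately_holomorphic_on (g i) (ball p0 \<epsilon> \<times> ball q0 \<epsilon>)"
      unfolding g_def using separately_holomorphic_subset[OF sep(2)[OF i] \<epsilon>(2)]
      by (intro separately_holomorphic_mult separately_holomorphic_minus separately_holomorphic_snd)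
    fix z assume z: "z \<in> ball p0 \<epsilon> \<times> ball q0 \<epsilon>"
    then have zU: "z \<in> U" using \<epsilon>(2) by blast
    show "g i z \<noteq> 0" using snd_nz[OF i zU] q_nz[OF zU] by (simp add: g_def)
    have "fst (w i z) = - snd (w i z) * x i z" using snd_nz[OF i zU] by (simp add: x_def)
    also have "x i z = snd z * \<sigma> i (fst z)"
      using x_eq[OF i, of "fst z" "snd z"] z by (simp add: mem_Times_iff)
    finally show "w i z = (g i z * \<sigma> i (fst z), - (g i z * 1 / snd z))"
      using q_nz[OF zU] by (simp add: g_def prod_eq_iff)
  next
    fix i j p assume ij: "i \<in> J" "j \<in> J" "i \<noteq> j" and p: "p \<in> ball p0 \<epsilon>"
    show "\<sigma> j p * 1 \<noteq> \<sigma> i p * 1"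
      using x_neq[OF ij box[OF p q0(1)]] q0(2) by (simp add: \<sigma>)
  qed simp_all
  assume p: "p \<in> ball p0 \<epsilon>"
  show "(\<lambda>i. \<sigma> i p) ` J = {s. binary_form n (a + smult p b) s (p * s - 1) = 0}"
    using root_set[OF p q0(1)] by (simp add: \<sigma> c_def)
qed

section \<open>The foliation \<open>dp\<close> among arbitrary local forms\<close>

lemma invariant_forms_insert:
  assumes w: "invariant_forms P Q J w g \<sigma> (\<lambda>_. 1)" and i0: "i0 \<notin> J"
    and hol: "separately_holomorphic_on (\<lambda>z. fst (w i0 z)) (P \<times> Q)"
    and nz: "\<And>z. z \<in> P \<times> Q \<Longrightarrow> fst (w i0 z) \<noteq> 0" and 0: "\<And>z. z \<in> P \<times> Q \<Longrightarrow> snd (w i0 z) = 0"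
  shows "invariant_forms P Q (insert i0 J) w (g(i0 := \<lambda>z. fst (w i0 z))) (\<sigma>(i0 := \<lambda>_. 1))
    (\<lambda>i. if i = i0 then 0 else 1)"
proof -
  interpret W: invariant_forms P Q J w g \<sigma> "\<lambda>_. 1" by (rule w)
  \<comment> \<open>The form \<open>w i0\<close> is an arbitrary nonvanishing multiple of
    \<open>dp\<close>, so its entire coefficient is taken as the factor \<open>g\<close> and leaves
    \<open>\<sigma> = 1\<close>, \<open>\<tau> = 0\<close>.\<close>
  show ?thesis
  proof
    show "open P" "open Q" "0 \<notin> Q" by (rule W.open_P W.open_Q W.Q_nz)+
  next
    fix i assume i: "i \<in> insert i0 J"
    show "(\<sigma>(i0 := \<lambda>_. 1)) i holomorphic_on P" using i W.holo by (cases "i = i0") auto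
    show "separately_holomorphic_on ((g(i0 := \<lambda>z. fst (w i0 z))) i) (P \<times> Q)"
      using i W.sep hol by (cases "i = i0") auto
    fix z assume z: "z \<in> P \<times> Q"
    show "(g(i0 := \<lambda>z. fst (w i0 z))) i z \<noteq> 0"
      using i W.g_nz[OF _ z] nz[OF z] by (cases "i = i0") auto
    show "w i z = ((g(i0 := \<lambda>z. fst (w i0 z))) i z * (\<sigma>(i0 := \<lambda>_. 1)) i (fst z),
        - ((g(i0 := \<lambda>z. fst (w i0 z))) i z * (if i = i0 then 0 else 1) / snd z))"
      using i W.w_eq[OF _ z] 0[OF z] by (cases "i = i0") (auto simp: prod_eq_iff)
  next
    fix i j p assume "i \<in> insert i0 J" "j \<in> insert i0 J" "i \<noteq> j" "p \<in> P"
    then show "(\<sigma>(i0 := \<lambda>_. 1)) j p * (if i = i0 then 0 else 1) \<noteq>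
        (\<sigma>(i0 := \<lambda>_. 1)) i p * (if j = i0 then 0 else 1)"
      using W.transverse[of i j p] by auto
  qed
qed

text \<open>A priori the index of the vertical form could change from point to point. At
  \<open>z0\<close> it is some \<open>i0\<close>; by transversality all other forms are non-vertical
  there, and by continuity they remain so on a neighbourhood, which leaves only \<open>i0\<close>
  for the vertical direction.\<close>

lemma prefoliation_forms_split:
  assumes w: "web_forms k (leg_prefoliation (line_infinity, H)) U w" and z0: "z0 \<in> U"
  obtains i0 V where "i0 < k" "open V" "z0 \<in> V" "V \<subseteq> U"
    "\<forall>z\<in>V. snd (w i0 z) = 0" "\<forall>z\<in>V. fst (w i0 z) \<noteq> 0"
    "\<forall>z\<in>V. leg_foliation H z = (\<lambda>i. form_kernel (w i) z) ` ({..<k} - {i0})"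
proof -
  let ?v = "{v :: complex \<times> complex. fst v = 0}"
  have U: "open U" and hol: "\<And>i. i < k \<Longrightarrow> holomorphic2_on (\<lambda>z. snd (w i z)) U"
    and nz: "\<And>i z. i < k \<Longrightarrow> z \<in> U \<Longrightarrow> w i z \<noteq> 0"
    and tr: "\<And>i j z. i < k \<Longrightarrow> j < k \<Longrightarrow> i \<noteq> j \<Longrightarrow> z \<in> U \<Longrightarrow> wedge (w i) (w j) z \<noteq> 0"
    and im: "\<And>z. z \<in> U \<Longrightarrow> insert ?v (leg_foliation H z) = (\<lambda>i. form_kernel (w i) z) ` {..<k}"
    using w unfolding web_forms_def leg_prefoliation_infinity by blast+
  have vert: "snd (w i z) = 0 \<longleftrightarrow> (0, 1) \<in> form_kernel (w i) z" for i z
    by (simp add: form_kernel_def)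
  have "?v \<in> (\<lambda>i. form_kernel (w i) z0) ` {..<k}" using im[OF z0] by blast
  then obtain i0 where i0: "i0 < k" "form_kernel (w i0) z0 = ?v" by auto
  have i0z: "snd (w i0 z0) = 0" unfolding vert i0(2) by simp
  have other: "snd (w i z0) \<noteq> 0" if "i < k" "i \<noteq> i0" for i
    using tr[OF i0(1) that(1) that(2)[symmetric] z0] i0z by (auto simp: wedge_def)
  have "eventually (\<lambda>z. snd (w i z) \<noteq> 0) (nhds z0)" if "i < k" "i \<noteq> i0" for i
  proof -
    have "continuous_on U (\<lambda>z. snd (w i z))"
      using holomorphic2_imp_separately[OF hol[OF that(1)]] by (simp add: separately_holomorphic_on_def)
    then have "isCont (\<lambda>z. snd (w i z)) z0" using U z0 by (simp add: continuous_on_eq_continuous_at)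
    then have "((\<lambda>z. snd (w i z)) \<longlongrightarrow> snd (w i z0)) (nhds z0)"
      using tendsto_at_iff_tendsto_nhds[of "\<lambda>z. snd (w i z)" z0] unfolding isCont_def by simp
    then show ?thesis using other[OF that] by (rule tendsto_imp_eventually_ne)
  qed
  then have "eventually (\<lambda>z. \<forall>i\<in>{..<k} - {i0}. snd (w i z) \<noteq> 0) (nhds z0)"
    by (intro eventually_ball_finite) auto
  moreover have "eventually (\<lambda>z. z \<in> U) (nhds z0)" using U z0 by (rule eventually_nhds_in_open)
  ultimately have "eventually (\<lambda>z. (\<forall>i\<in>{..<k} - {i0}. snd (w i z) \<noteq> 0) \<and> z \<in> U) (nhds z0)"
    by (rule eventually_conj)
  then obtain V where V: "open V" "z0 \<in> V" "V \<subseteq> U" "\<And>i z. i < k \<Longrightarrow> i \<noteq> i0 \<Longrightarrow> z \<in> V \<Longrightarrow> snd (w i z) \<noteq> 0"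
    unfolding eventually_nhds by (metis (no_types, lifting) DiffI lessThan_iff singletonD subsetI)
  have main: "snd (w i0 z) = 0 \<and> fst (w i0 z) \<noteq> 0 \<and>
      leg_foliation H z = (\<lambda>i. form_kernel (w i) z) ` ({..<k} - {i0})" if z: "z \<in> V" for z
  proof (intro conjI)
    have zU: "z \<in> U" using z V(3) by blast
    have "?v \<in> (\<lambda>i. form_kernel (w i) z) ` {..<k}" using im[OF zU] by blast
    then obtain i where i: "i < k" "form_kernel (w i) z = ?v" by auto
    then have iz: "snd (w i z) = 0" unfolding vert by simp
    then have "i = i0" using V(4)[OF i(1) _ z] by blast
    then show s0: "snd (w i0 z) = 0" using iz by simp
    show "fst (w i0 z) \<noteq> 0" using nz[OF i0(1) zU] s0 by (simp add: prod_eq_iff)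
    have ker0: "form_kernel (w i0) z = ?v" using i(2) \<open>i = i0\<close> by simp
    have "leg_foliation H z = insert ?v (leg_foliation H z) - {?v}"
    proof -
      have "?v \<notin> leg_foliation H z"
      proof
        assume "?v \<in> leg_foliation H z"
        then obtain x where "?v = {v. snd v = x * fst v}" unfolding leg_foliation_slopes by blast
        moreover have "(0, 1) \<in> ?v" by simp
        ultimately have "(0, 1) \<in> {v. snd v = x * fst v}" by blast
        then show False by simp
      qed
      then show ?thesis by blast
    qed
    also have "\<dots> = (\<lambda>i. form_kernel (w i) z) ` {..<k} - {?v}" unfolding im[OF zU] ..
    also have "\<dots> = (\<lambda>i. form_kernel (w i) z) ` ({..<k} - {i0})"
    proof -
      have "form_kernel (w i) z \<noteq> ?v" if "i < k" "i \<noteq> i0" for i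
      proof
        assume "form_kernel (w i) z = ?v"
        then have "snd (w i z) = 0" unfolding vert by simp
        then show False using V(4)[OF that z] by contradiction
      qed
      then show ?thesis using ker0 by auto
    qed
    finally show "leg_foliation H z = (\<lambda>i. form_kernel (w i) z) ` ({..<k} - {i0})" .
  qed
  show ?thesis
    by (rule that[OF i0(1) V(1-3)]) (use main in blast)+
qed

text \<open>Whatever forms are chosen, the reduced slopes over a given \<open>p\<close> make up the
  root set of the tangency equation at \<open>q = 1\<close>. Both decompositions therefore have the
  same slopes over a common box, up to numbering. As both families of forms are arbitrary, the
  equality also contains the independence of the curvature from the choice.\<close>

lemma forms_curvature_leg_prefoliation:
  assumes deg: "degree a \<le> n" "degree b \<le> n"
    and tang: "\<And>p q x. poly (tangency H (p, q)) x = binary_form n (a + smult p b) x (p * x - q)"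
    and n: "n \<ge> 2"
    and w: "web_forms n (leg_foliation H) U w" and z: "z \<in> U"
    and w': "web_forms (Suc n) (leg_prefoliation (line_infinity, H)) U' w'" and z': "z \<in> U'"
  shows "forms_curvature (Suc n) w' z = forms_curvature n w z"
proof -
  obtain i0 V where i0: "i0 < Suc n" and V: "open V" "z \<in> V" "V \<subseteq> U'"
    and w0: "\<forall>z\<in>V. snd (w' i0 z) = 0" "\<forall>z\<in>V. fst (w' i0 z) \<noteq> 0"
    and legV: "\<forall>z\<in>V. leg_foliation H z = (\<lambda>i. form_kernel (w' i) z) ` ({..<Suc n} - {i0})"
    using prefoliation_forms_split[OF w' z'] .
  let ?J = "{..<Suc n} - {i0}"
  have "open (U \<inter> V)" "z \<in> U \<inter> V" using w V z by (auto simp: web_forms_def)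
  then obtain r where r: "0 < r" "cball (fst z) r \<times> cball (snd z) r \<subseteq> U \<inter> V"
    using box_in_open by blast
  let ?P = "ball (fst z) r" and ?Q = "ball (snd z) r"
  have "?P \<times> ?Q \<subseteq> cball (fst z) r \<times> cball (snd z) r" by (intro Sigma_mono ball_subset_cball)
  then have sub: "?P \<times> ?Q \<subseteq> U" "?P \<times> ?Q \<subseteq> V" using r(2) by blast+
  have hol: "\<And>i. i \<in> {..<n} \<Longrightarrow> holomorphic2_on (\<lambda>z. fst (w i z)) U"
      "\<And>i. i \<in> {..<n} \<Longrightarrow> holomorphic2_on (\<lambda>z. snd (w i z)) U"
      "\<And>i j z. i \<in> {..<n} \<Longrightarrow> j \<in> {..<n} \<Longrightarrow> i \<noteq> j \<Longrightarrow> z \<in> U \<Longrightarrow> wedge (w i) (w j) z \<noteq> 0"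
      "\<And>z. z \<in> U \<Longrightarrow> leg_foliation H z = (\<lambda>i. form_kernel (w i) z) ` {..<n}"
    using w unfolding web_forms_def lessThan_iff by blast+
  have holU': "\<And>i. i < Suc n \<Longrightarrow> holomorphic2_on (\<lambda>z. fst (w' i z)) U'"
      "\<And>i. i < Suc n \<Longrightarrow> holomorphic2_on (\<lambda>z. snd (w' i z)) U'"
      "\<And>i j z. i < Suc n \<Longrightarrow> j < Suc n \<Longrightarrow> i \<noteq> j \<Longrightarrow> z \<in> U' \<Longrightarrow> wedge (w' i) (w' j) z \<noteq> 0"
    using w' unfolding web_forms_def by blast+
  have holV: "holomorphic2_on (\<lambda>z. fst (w' i z)) V" "holomorphic2_on (\<lambda>z. snd (w' i z)) V"
    if "i < Suc n" for i
    using holU'(1,2)[OF that] V(3) unfolding holomorphic2_on_def by blast+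
  have hol': "\<And>i. i \<in> ?J \<Longrightarrow> holomorphic2_on (\<lambda>z. fst (w' i z)) V"
      "\<And>i. i \<in> ?J \<Longrightarrow> holomorphic2_on (\<lambda>z. snd (w' i z)) V"
      "\<And>i j z. i \<in> ?J \<Longrightarrow> j \<in> ?J \<Longrightarrow> i \<noteq> j \<Longrightarrow> z \<in> V \<Longrightarrow> wedge (w' i) (w' j) z \<noteq> 0"
    using holV holU'(3) V(3) by blast+
  have cards: "finite {..<n}" "card {..<n} \<ge> 2" "finite ?J" "card ?J \<ge> 2"
    using n i0 by auto
  let ?\<sigma> = "\<lambda>w i p. - fst (w i (p, snd z)) / snd (w i (p, snd z)) / snd z"
  let ?g = "\<lambda>w i z. - snd (w i z :: complex \<times> complex) * snd (z :: point)"
  have W: "invariant_forms ?P ?Q {..<n} w (?g w) (?\<sigma> w) (\<lambda>_. 1)"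
    by (rule leg_invariant_forms(1)[OF deg tang cards(1,2) r(1) sub(1)]) (rule hol; assumption)+
  have W_img: "(\<lambda>i. ?\<sigma> w i p) ` {..<n} = {s. binary_form n (a + smult p b) s (p * s - 1) = 0}"
    if "p \<in> ?P" for p
    by (rule leg_invariant_forms(2)[OF deg tang cards(1,2) r(1) sub(1) _ _ _ _ that]) (rule hol; assumption)+
  have W': "invariant_forms ?P ?Q ?J w' (?g w') (?\<sigma> w') (\<lambda>_. 1)"
    by (rule leg_invariant_forms(1)[OF deg tang cards(3,4) r(1) sub(2)])
      (rule hol' legV[rule_format]; assumption)+
  have W'_img: "(\<lambda>i. ?\<sigma> w' i p) ` ?J = {s. binary_form n (a + smult p b) s (p * s - 1) = 0}"
    if "p \<in> ?P" for p
    by (rule leg_invariant_forms(2)[OF deg tang cards(3,4) r(1) sub(2) _ _ _ _ that])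
      (rule hol' legV[rule_format]; assumption)+
  have "invariant_forms ?P ?Q (insert i0 ?J) w' ((?g w')(i0 := \<lambda>z. fst (w' i0 z)))
      ((?\<sigma> w')(i0 := \<lambda>_. 1)) (\<lambda>i. if i = i0 then 0 else 1)"
  proof (rule invariant_forms_insert[OF W'])
    show "separately_holomorphic_on (\<lambda>z. fst (w' i0 z)) (?P \<times> ?Q)"
      using separately_holomorphic_subset[OF holomorphic2_imp_separately[OF holV(1)[OF i0]] sub(2)] .
    fix z' assume "z' \<in> ?P \<times> ?Q"
    then have "z' \<in> V" using sub(2) by blast
    then show "fst (w' i0 z') \<noteq> 0" "snd (w' i0 z') = 0" using w0 by blast+
  qed simp
  moreover have "insert i0 ?J = {..<Suc n}" using i0 by auto
  ultimately have W0: "invariant_forms ?P ?Q {..<Suc n} w' ((?g w')(i0 := \<lambda>z. fst (w' i0 z)))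
      ((?\<sigma> w')(i0 := \<lambda>_. 1)) (\<lambda>i. if i = i0 then 0 else 1)"
    by (simp only:)
  show ?thesis
  proof (rule forms_curvature_add_fibration[OF W W0 i0])
    show "z \<in> ?P \<times> ?Q" using r(1) by (simp add: mem_Times_iff)
    fix p assume p: "p \<in> ?P"
    have "(\<lambda>j. ((?\<sigma> w')(i0 := \<lambda>_. 1)) j p) ` ?J = (\<lambda>j. ?\<sigma> w' j p) ` ?J"
      by (rule image_cong) auto
    then show "(\<lambda>i. ?\<sigma> w i p) ` {..<n} = (\<lambda>j. ((?\<sigma> w')(i0 := \<lambda>_. 1)) j p) ` ?J"
      unfolding W_img[OF p] W'_img[OF p] by (rule sym)
  qed
qed

text \<open>One direction appends \<open>dp\<close>, the other deletes the vertical form and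
  renumbers the rest. Consequently the flatness of the two webs is tested at the same
  points.\<close>

lemma web_regular_at_leg_prefoliation:
  "web_regular_at (Suc n) (leg_prefoliation (line_infinity, H)) z \<longleftrightarrow> web_regular_at n (leg_foliation H) z"
proof
  assume "web_regular_at n (leg_foliation H) z"
  then show "web_regular_at (Suc n) (leg_prefoliation (line_infinity, H)) z"
    unfolding web_regular_at_def using web_forms_add_infinity by blast
next
  assume "web_regular_at (Suc n) (leg_prefoliation (line_infinity, H)) z"
  then obtain U w where z: "z \<in> U" and w: "web_forms (Suc n) (leg_prefoliation (line_infinity, H)) U w"
    unfolding web_regular_at_def by blast
  obtain i0 V where i0: "i0 < Suc n" and V: "open V" "z \<in> V" "V \<subseteq> U"
    and "\<forall>z\<in>V. snd (w i0 z) = 0" "\<forall>z\<in>V. fst (w i0 z) \<noteq> 0"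
    and leg: "\<forall>z\<in>V. leg_foliation H z = (\<lambda>i. form_kernel (w i) z) ` ({..<Suc n} - {i0})"
    using prefoliation_forms_split[OF w z] .
  have "card ({..<Suc n} - {i0}) = n" using i0 by simp
  then obtain e where e: "bij_betw e {..<n} ({..<Suc n} - {i0})"
    using ex_bij_betw_nat_finite[of "{..<Suc n} - {i0}"] by (auto simp: atLeast0LessThan)
  have e_lt: "e i < Suc n" if "i < n" for i using bij_betwE[OF e] that by auto
  have e_neq: "e i \<noteq> e j" if "i < n" "j < n" "i \<noteq> j" for i j
    using bij_betw_imp_inj_on[OF e] that by (auto simp: inj_on_def)
  have img: "e ` {..<n} = {..<Suc n} - {i0}" using e by (rule bij_betw_imp_surj_on)
  have "web_forms n (leg_foliation H) V (\<lambda>i. w (e i))"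
    unfolding web_forms_def
  proof (intro conjI allI impI ballI)
    fix i assume i: "i < n"
    have "holomorphic2_on (\<lambda>z. fst (w (e i) z)) U" "holomorphic2_on (\<lambda>z. snd (w (e i) z)) U"
      using w e_lt[OF i] by (simp_all add: web_forms_def)
    then show "holomorphic2_on (\<lambda>z. fst (w (e i) z)) V" "holomorphic2_on (\<lambda>z. snd (w (e i) z)) V"
      using V(3) unfolding holomorphic2_on_def by blast+
    fix z assume "z \<in> V"
    then have "z \<in> U" using V(3) by blast
    then show "w (e i) z \<noteq> 0" using w e_lt[OF i] by (simp add: web_forms_def)
  next
    fix i j z assume ij: "i < n" "j < n" "i \<noteq> j" and "z \<in> V"
    then have "z \<in> U" using V(3) by blast
    then show "wedge (w (e i)) (w (e j)) z \<noteq> 0"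
      using w e_lt[OF ij(1)] e_lt[OF ij(2)] e_neq[OF ij] by (simp add: web_forms_def)
  next
    fix z assume "z \<in> V"
    then show "leg_foliation H z = (\<lambda>i. form_kernel (w (e i)) z) ` {..<n}"
      using leg by (simp only: img[symmetric] image_image)
  qed (rule V(1))
  then show "web_regular_at n (leg_foliation H) z"
    unfolding web_regular_at_def using V(2) by blast
qed

section \<open>Passage from local forms to the curvature of the web\<close>

lemma curvature_eqI:
  assumes "z \<in> U" "web_forms k W U w"
    and "\<And>U w. z \<in> U \<Longrightarrow> web_forms k W U w \<Longrightarrow> forms_curvature k w z = c"
  shows "curvature k W z = c"
  unfolding curvature_def
proof (rule the_equality)
  have "c = forms_curvature k w z" by (rule assms(3)[OF assms(1,2), symmetric])
  with assms(1,2) show "\<exists>U w. z \<in> U \<and> web_forms k W U w \<and> c = forms_curvature k w z" by blast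
next
  fix c' assume "\<exists>U w. z \<in> U \<and> web_forms k W U w \<and> c' = forms_curvature k w z"
  then obtain U' w' where "z \<in> U'" "web_forms k W U' w'" "c' = forms_curvature k w' z" by blast
  then show "c' = c" using assms(3)[of U' w'] by simp
qed

theorem theorem3p1:
  fixes d :: nat and H :: foliation
  assumes "d \<ge> 3"
    and "foliation_of_degree (d - 1) H"
    and "homogeneous H"
  shows "is_web (d - 1) (leg_foliation H)
    \<and> is_web d (leg_prefoliation (line_infinity, H))
    \<and> (\<forall>z. web_regular_at d (leg_prefoliation (line_infinity, H)) z \<and>
           web_regular_at (d - 1) (leg_foliation H) z \<longrightarrow>
           curvature d (leg_prefoliation (line_infinity, H)) z = curvature (d - 1) (leg_foliation H) z)
    \<and> (flat_web d (leg_prefoliation (line_infinity, H)) \<longleftrightarrow> flat_web (d - 1) (leg_foliation H))"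
proof -
  obtain n where n: "n \<ge> 2" "d = Suc n" "d - 1 = n"
    using assms(1) by (intro that[of "d - 1"]) auto
  obtain a b where deg: "degree a \<le> n" "degree b \<le> n"
    and cop': "\<forall>u. \<not> (poly a u = 0 \<and> poly b u = 0)"
    and lead: "coeff a n \<noteq> 0 \<or> coeff b n \<noteq> 0" and radial: "a + [:0, 1:] * b \<noteq> 0"
    and tang': "\<forall>p q x. poly (tangency H (p, q)) x = binary_form n (a + smult p b) x (p * x - q)"
    using homogeneous_foliation_cases[OF n(1) assms(2)[unfolded n(3)] assms(3)] .
  note cop = cop'[rule_format] and tang = tang'[rule_format]
  let ?W = "leg_foliation H" and ?W' = "leg_prefoliation (line_infinity, H)"
  have web: "is_web n ?W"
    by (rule leg_foliation_is_web[OF deg cop _ lead radial tang]) (use n(1) in linarith)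
  have reg: "web_regular_at (Suc n) ?W' = web_regular_at n ?W"
    by (rule ext) (rule web_regular_at_leg_prefoliation)
  have web': "is_web (Suc n) ?W'"
    using web unfolding is_web_def reg .
  have curv: "curvature (Suc n) ?W' z = curvature n ?W z" if z: "web_regular_at n ?W z" for z
  proof -
    obtain U w where w: "z \<in> U" "web_forms n ?W U w"
      using z unfolding web_regular_at_def by blast
    obtain U' w' where w': "z \<in> U'" "web_forms (Suc n) ?W' U' w'"
      using z[folded reg] unfolding web_regular_at_def by blast
    note eq = forms_curvature_leg_prefoliation[OF deg tang n(1)]
    have "curvature (Suc n) ?W' z = forms_curvature n w z"
      by (rule curvature_eqI[OF w']) (rule eq[OF w(2,1)])
    \<comment> \<open>Two decompositions of Leg H have equal curvature because both are compared
      with one and the same decomposition \<open>w'\<close> of the larger web.\<close>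
    moreover have "curvature n ?W z = forms_curvature n w z"
    proof (rule curvature_eqI[OF w])
      fix V v assume v: "z \<in> V" "web_forms n ?W V v"
      show "forms_curvature n v z = forms_curvature n w z"
        using eq[OF v(2,1) w'(2,1)] eq[OF w(2,1) w'(2,1)] by simp
    qed
    ultimately show ?thesis by simp
  qed
  have flat: "flat_web (Suc n) ?W' \<longleftrightarrow> flat_web n ?W"
    unfolding flat_web_def reg using curv by metis
  show ?thesis
    unfolding n(3) unfolding n(2)
  proof (intro conjI allI impI)
    fix z assume "web_regular_at (Suc n) ?W' z \<and> web_regular_at n ?W z"
    then show "curvature (Suc n) ?W' z = curvature n ?W z" using curv by simp
  qed (rule web web' flat)+
qed

end
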